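(* Let $n \geq 1$. The algebraic multiplicity $m_n$ of the eigenvalue $1$ of $R_n^*$ satisfies $m_n = n - k_n$, where the sequence $(k_n)$ is defined by $k_1=0$ and $k_n = \max(k_{n-1}, \omega(n)+1)$ for $n\ge 2$. In particular, $$n - \left\lfloor \frac{1.3841\,\log n}{\log\log n}\right\rfloor - 1 \leq m_n \quad (n\ge 3), \qquad m_n \leq n - \left\lfloor \frac{\log n}{\log\log n}\right\rfloor \quad (n \geq 6).$$ Moreover, for every $n\ge 3$, $$\left| m_n - n + \frac{\log n}{\log\log n}\right| \leq \frac{2\log n}{(\log\log n)^2}.$$
   Context: $\omega(m)$ denotes the number of distinct prime factors of $m$. For positive integers $i,j$, $i \parallel j$ means $i \mid j$ and $\gcd(i,j/i)=1$. $R_n^*=(\rho_{ij})_{1\le i,j\le n}$ is the $n\times n$ matrix with $\rho_{ij}=1$ if $i \parallel j$ or $j=1$, and $\rho_{ij}=0$ otherwise. The algebraic multiplicity of the eigenvalue $1$ is its multiplicity as a root of the characteristic polynomial $\det(\lambda I_n - R_n^* )$. *)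

theory Defs
  imports Complex_Main "Jordan_Normal_Form.Char_Poly" "HOL-Computational_Algebra.Primes"
begin

definition unitary_dvd :: "nat \<Rightarrow> nat \<Rightarrow> bool" where
  "unitary_dvd i j \<longleftrightarrow> i dvd j \<and> gcd i (j div i) = 1"

definition omega :: "nat \<Rightarrow> nat" where
  "omega m = card (prime_factors m)"

text \<open>The n x n matrix R_n^*, with 1-based indices i,j shifted to 0-based.\<close>
definition Rstar :: "nat \<Rightarrow> real mat" where
  "Rstar n = mat n n (\<lambda>(i, j). if unitary_dvd (i + 1) (j + 1) \<or> j + 1 = 1 then 1 else 0)"

definition mult_one :: "nat \<Rightarrow> nat" where
  "mult_one n = order 1 (char_poly (Rstar n))"

text \<open>k_1 = 0, k_n = max(k_{n-1}, omega n + 1) for n >= 2 (k_0 is an unused dummy).\<close>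
fun kseq :: "nat \<Rightarrow> nat" where
  "kseq 0 = 0"
| "kseq (Suc 0) = 0"
| "kseq (Suc (Suc m)) = max (kseq (Suc m)) (omega (Suc (Suc m)) + 1)"

end

theory Submission
  imports "HOL-Number_Theory.Eratosthenes" "HOL-Analysis.Complex_Transcendental" Defs
begin

text \<open>Put \<open>x = X - 1\<close>. Weighting the rows of \<open>X I - R_n^*\<close> by generating functions of the chains of
  proper unitary divisors starting at \<open>1\<close> clears all columns but the first, so the characteristic
  polynomial is \<open>x^n - (\<Sum>k \<ge> 1. s_k x^(n - 1 - k))\<close>, where \<open>s_k\<close> counts the chains of length \<open>k\<close>
  ending in \<open>{2..n}\<close>. A chain ending in \<open>m\<close> has length at most \<open>\<omega>(m)\<close> and this is attained, so for
  \<open>n \<ge> 2\<close> the order of vanishing at \<open>x = 0\<close> is \<open>n - 1 - max \<omega>\<close>.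

  A number with \<open>r\<close> prime factors is at least the product of the first \<open>r\<close> primes, so everything
  reduces to comparing \<open>\<pi>(t)\<close> with functions of \<open>L = \<theta>(t)\<close>. When \<open>t\<close> passes a prime \<open>p\<close>, \<open>\<pi>\<close> grows
  by \<open>1\<close> and \<open>L\<close> by \<open>ln p\<close>, so by the mean value theorem \<open>L / ln L\<close> and \<open>L / ln L + 2 L / (ln L)^2\<close>
  grow by about \<open>1\<close> as soon as \<open>p\<close> is comparable with \<open>L\<close>. Hence Chebyshev's estimates suffice:
  \<open>\<theta>(t) \<le> t ln 4\<close> for the upper bounds on \<open>\<omega>\<close>, and \<open>t + 1 \<le> e \<theta>(t)\<close> for the lower bound. The
  remaining finite range is checked with explicit values of \<open>\<theta>\<close>; the constant 1.3841 is nearly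
  attained by the product of the first nine primes.\<close>


section \<open>The characteristic polynomial\<close>

lemma cofactor_0_0_upper_triangular:
  fixes A :: "'a :: comm_ring_1 mat"
  assumes A: "A \<in> carrier_mat n n" and n: "n > 0"
    and triangular: "\<And>i j. 0 < j \<Longrightarrow> j < i \<Longrightarrow> i < n \<Longrightarrow> A $$ (i, j) = 0"
  shows "cofactor A 0 0 = (\<Prod>i=1..<n. A $$ (i, i))"
proof -
  have dim: "mat_delete A 0 0 \<in> carrier_mat (n - 1) (n - 1)"
    using A mat_delete_carrier by blast
  have index: "mat_delete A 0 0 $$ (i, j) = A $$ (Suc i, Suc j)" if "i < n - 1" "j < n - 1" for i j
    using that A by (simp add: mat_delete_def)
  have "det (mat_delete A 0 0) = prod_list (diag_mat (mat_delete A 0 0))"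
    using A triangular
    by (intro det_upper_triangular[OF _ dim] upper_triangularI) (simp add: index)
  also have "\<dots> = (\<Prod>i<n - 1. A $$ (Suc i, Suc i))"
    using carrier_matD[OF A] by (simp add: prod_list_diag_prod index lessThan_atLeast0)
  also have "\<dots> = (\<Prod>i=1..<n. A $$ (i, i))"
    by (rule prod.reindex_bij_witness[of _ "\<lambda>i. i - 1" Suc]) auto
  finally show ?thesis by (simp add: cofactor_def)
qed

text \<open>If \<open>y\<close> times \<open>A\<close> is supported on the first column, multiply by the adjugate of \<open>A\<close> and
  compare the first entries.\<close>

lemma det_eq_if_row_combination:
  fixes A :: "'a :: comm_ring_1 mat"
  assumes A: "A \<in> carrier_mat n n" and n: "n > 0"
    and clear: "\<And>j. 0 < j \<Longrightarrow> j < n \<Longrightarrow> (\<Sum>i<n. y i * A $$ (i, j)) = 0"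
    and triangular: "\<And>i j. 0 < j \<Longrightarrow> j < i \<Longrightarrow> i < n \<Longrightarrow> A $$ (i, j) = 0"
  shows "y 0 * det A = (\<Sum>i<n. y i * A $$ (i, 0)) * (\<Prod>i=1..<n. A $$ (i, i))"
proof -
  have adj: "(\<Sum>j<n. A $$ (i, j) * cofactor A 0 j) = (if i = 0 then det A else 0)" if "i < n" for i
  proof -
    have "(A * adj_mat A) $$ (i, 0) = (\<Sum>j<n. A $$ (i, j) * cofactor A 0 j)"
      using that n A by (simp add: adj_mat_def scalar_prod_def lessThan_atLeast0)
    then show ?thesis
      using that n unfolding adj_mat(2)[OF A] by (auto split: if_splits)
  qed
  have "y 0 * det A = (\<Sum>i<n. y i * (if i = 0 then det A else 0))"
    using n by (simp add: if_distrib cong: if_cong)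
  also have "\<dots> = (\<Sum>i<n. y i * (\<Sum>j<n. A $$ (i, j) * cofactor A 0 j))"
    by (intro sum.cong) (simp_all add: adj)
  also have "\<dots> = (\<Sum>j<n. (\<Sum>i<n. y i * A $$ (i, j)) * cofactor A 0 j)"
    unfolding sum_distrib_left sum_distrib_right by (subst sum.swap) (simp add: mult.assoc)
  also have "\<dots> = (\<Sum>j\<in>{0}. (\<Sum>i<n. y i * A $$ (i, j)) * cofactor A 0 j)"
    using n clear by (intro sum.mono_neutral_right) auto
  finally show ?thesis using cofactor_0_0_upper_triangular[OF A n triangular] by simp
qed

lemma omega_1 [simp]: "omega (Suc 0) = 0"
  by (simp add: omega_def)

lemma unitary_dvd_imp_le: "unitary_dvd i j \<Longrightarrow> j > 0 \<Longrightarrow> i \<le> j"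
  by (auto simp: unitary_dvd_def dvd_imp_le)

lemma unitary_dvd_imp_pos: "unitary_dvd i j \<Longrightarrow> j > 0 \<Longrightarrow> i > 0"
  by (auto simp: unitary_dvd_def intro: Nat.gr0I)

lemma omega_mult_coprime:
  assumes "coprime a b" "a > 0" "b > 0"
  shows "omega (a * b) = omega a + omega b"
proof -
  have "prime_factors a \<inter> prime_factors b = {}"
    using assms(1) by (auto simp: in_prime_factors_iff dest: coprime_common_divisor)
  then show ?thesis
    using assms by (simp add: omega_def prime_factors_product card_Un_disjoint)
qed

lemma omega_pos: "n \<ge> 2 \<Longrightarrow> omega n > 0"
  by (auto simp: omega_def card_gt_0_iff prime_factorization_empty_iff)

lemma omega_prime_power:
  assumes "prime p" "e > 0"
  shows "omega (p ^ e) = 1"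
  using assms by (simp add: omega_def prime_factorization_prime_power)

lemma omega_less_if_unitary_dvd:
  assumes "unitary_dvd i j" "i < j"
  shows "omega i < omega j"
proof -
  from assms obtain q where q: "j = i * q"
    by (auto simp: unitary_dvd_def)
  have pos: "i > 0" using assms by (intro unitary_dvd_imp_pos[OF assms(1)]) auto
  have "q \<ge> 2" using assms(2) q by (cases q) auto
  moreover have "coprime i q"
    using assms q pos by (simp add: unitary_dvd_def coprime_iff_gcd_eq_1)
  ultimately show ?thesis
    using pos omega_pos[of q] by (simp add: q omega_mult_coprime)
qed

lemma ex_unitary_dvd_omega:
  assumes "j \<ge> 2"
  obtains i where "unitary_dvd i j" "i < j" "i > 0" "omega j = Suc (omega i)"
proof -
  obtain p where p: "prime p" "p dvd j"
    using assms prime_factor_nat[of j] by auto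
  define q where "q = p ^ multiplicity p j"
  have mult: "multiplicity p j > 0"
    using p assms by (simp add: prime_multiplicity_gt_zero_iff)
  have "j \<noteq> 0" "\<not> is_unit p"
    using assms p by auto
  then obtain i where i: "j = q * i" "\<not> p dvd i"
    unfolding q_def using multiplicity_decompose'[of j p] by metis
  have pos: "i > 0" using i(2) by (cases i) auto
  have "q > 1"
    unfolding q_def using p(1) mult by (intro one_less_power prime_gt_1_nat)
  have coprime: "coprime q i"
    unfolding q_def using prime_imp_coprime[OF p(1) i(2)] by simp
  then have "omega j = Suc (omega i)"
    using omega_prime_power[OF p(1) mult, folded q_def] pos \<open>q > 1\<close>
    by (simp add: i(1) omega_mult_coprime)
  moreover have "unitary_dvd i j"
    using coprime pos by (simp add: i(1) unitary_dvd_def coprime_commute flip: coprime_iff_gcd_eq_1)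
  ultimately show ?thesis
    using that[of i] pos \<open>q > 1\<close> by (simp add: i(1))
qed

text \<open>\<open>unitary_chains k j\<close> counts the chains \<open>1 = d_0 < d_1 < ... < d_k = j\<close> in which each
  \<open>d_i\<close> is a unitary divisor of \<open>d_(i+1)\<close>.\<close>

fun unitary_chains :: "nat \<Rightarrow> nat \<Rightarrow> nat" where
  "unitary_chains 0 j = (if j = 1 then 1 else 0)"
| "unitary_chains (Suc k) j = (\<Sum>i | unitary_dvd i j \<and> i < j. unitary_chains k i)"

lemma unitary_chains_eq_0:
  assumes "j > 0" "omega j < k"
  shows "unitary_chains k j = 0"
  using assms
proof (induction k arbitrary: j)
  case (Suc k)
  have "unitary_chains k i = 0" if "unitary_dvd i j" "i < j" for i
    using that Suc omega_less_if_unitary_dvd[of i j] unitary_dvd_imp_pos[of i j] by auto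
  then show ?case by simp
qed simp

lemma unitary_chains_1: "unitary_chains k (Suc 0) = (if k = 0 then 1 else 0)"
  by (simp add: unitary_chains_eq_0)

lemma unitary_chains_omega_pos:
  assumes "j > 0"
  shows "unitary_chains (omega j) j > 0"
  using assms
proof (induction "omega j" arbitrary: j)
  case 0
  then have "j = 1" using omega_pos[of j] by (cases "j \<ge> 2") auto
  then show ?case by simp
next
  case (Suc k)
  then have "j \<noteq> 1" by auto
  with Suc.prems obtain i where i: "unitary_dvd i j" "i < j" "i > 0" "omega j = Suc (omega i)"
    using ex_unitary_dvd_omega[of j] by (metis One_nat_def Suc_1 Suc_leI le_neq_implies_less)
  then have "unitary_chains k i > 0" using Suc by simp
  with i show ?case
    unfolding Suc.hyps(2)[symmetric] by (auto simp: sum_nonneg_eq_0_iff intro!: Nat.gr0I)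
qed

text \<open>\<open>x ^ N\<close> times the generating function of \<open>unitary_chains\<close> at \<open>1 / x\<close>, which is a polynomial in
  \<open>x\<close> once \<open>N\<close> is at least the length of the longest chain.\<close>

definition chain_weight :: "'a :: comm_ring_1 \<Rightarrow> nat \<Rightarrow> nat \<Rightarrow> 'a" where
  "chain_weight x N j = (\<Sum>k\<le>N. of_nat (unitary_chains k j) * x ^ (N - k))"

lemma chain_weight_1: "chain_weight x N (Suc 0) = x ^ N"
proof -
  have "chain_weight x N (Suc 0) = (\<Sum>k\<in>{0}. of_nat (unitary_chains k (Suc 0)) * x ^ (N - k))"
    unfolding chain_weight_def by (intro sum.mono_neutral_right) (auto simp: unitary_chains_1)
  then show ?thesis by simp
qed

lemma sum_chain_weight_unitary_dvd:
  assumes "j \<ge> 2" "omega j \<le> N"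
  shows "(\<Sum>i | unitary_dvd i j \<and> i < j. chain_weight x N i) = x * chain_weight x N j"
proof -
  have "(\<Sum>i | unitary_dvd i j \<and> i < j. chain_weight x N i)
      = (\<Sum>k\<le>N. of_nat (unitary_chains (Suc k) j) * x ^ (N - k))"
    unfolding chain_weight_def by (subst sum.swap) (simp add: sum_distrib_right)
  also have "\<dots> = (\<Sum>k<N. of_nat (unitary_chains (Suc k) j) * x ^ (N - k))"
  proof (intro sum.mono_neutral_right ballI)
    fix k assume "k \<in> {..N} - {..<N}"
    then have "unitary_chains (Suc k) j = 0"
      using assms by (intro unitary_chains_eq_0) auto
    then show "of_nat (unitary_chains (Suc k) j) * x ^ (N - k) = 0"
      by (simp only: of_nat_0 mult_zero_left)
  qed auto
  also have "\<dots> = (\<Sum>k<N. x * (of_nat (unitary_chains (Suc k) j) * x ^ (N - Suc k)))"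
  proof (intro sum.cong refl)
    fix k assume "k \<in> {..<N}"
    then have "x ^ (N - k) = x * x ^ (N - Suc k)" by (simp add: Suc_diff_Suc flip: power_Suc)
    then show "of_nat (unitary_chains (Suc k) j) * x ^ (N - k)
        = x * (of_nat (unitary_chains (Suc k) j) * x ^ (N - Suc k))"
      by (simp only: mult.left_commute)
  qed
  also have "\<dots> = x * chain_weight x N j"
    using assms unfolding chain_weight_def sum_distrib_left by (subst sum.atMost_shift) simp
  finally show ?thesis .
qed

lemma char_poly_matrix_Rstar:
  "char_poly_matrix (Rstar n) \<in> carrier_mat n n"
  "i < n \<Longrightarrow> j < n \<Longrightarrow> char_poly_matrix (Rstar n) $$ (i, j)
    = (if i = j then [:-1, 1:] else if j = 0 \<or> unitary_dvd (Suc i) (Suc j) then -1 else 0)"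
proof -
  have "unitary_dvd (Suc j) (Suc j)" for j
    by (simp add: unitary_dvd_def)
  then show "i < n \<Longrightarrow> j < n \<Longrightarrow> char_poly_matrix (Rstar n) $$ (i, j)
      = (if i = j then [:-1, 1:] else if j = 0 \<or> unitary_dvd (Suc i) (Suc j) then -1 else 0)"
    by (auto simp: char_poly_matrix_def Rstar_def one_pCons)
  show "char_poly_matrix (Rstar n) \<in> carrier_mat n n"
    by (auto simp: char_poly_matrix_def Rstar_def)
qed

lemma sum_chain_weight_char_poly_matrix:
  assumes j: "0 < j" "j < n" and N: "omega (Suc j) \<le> N"
  shows "(\<Sum>i<n. chain_weight [:-1, 1:] N (Suc i) * char_poly_matrix (Rstar n) $$ (i, j)) = 0"
proof -
  define x :: "real poly" where "x = [:-1, 1:]"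
  define y where "y i = chain_weight x N (Suc i)" for i
  have "(\<Sum>i<n. y i * char_poly_matrix (Rstar n) $$ (i, j)) = (\<Sum>i<n. (if i = j then x * y i else 0)
      - (if i < j \<and> unitary_dvd (Suc i) (Suc j) then y i else 0))"
    using j by (intro sum.cong)
      (auto simp: char_poly_matrix_Rstar x_def mult.commute dest: unitary_dvd_imp_le)
  also have "\<dots> = x * y j - (\<Sum>i<n. if i < j \<and> unitary_dvd (Suc i) (Suc j) then y i else 0)"
    using j by (simp add: sum_subtractf)
  also have "(\<Sum>i<n. if i < j \<and> unitary_dvd (Suc i) (Suc j) then y i else 0)
      = (\<Sum>i | i < j \<and> unitary_dvd (Suc i) (Suc j). y i)"
    using j by (subst sum.inter_filter[symmetric]) (auto intro: sum.cong)
  also have "\<dots> = (\<Sum>i | unitary_dvd i (Suc j) \<and> i < Suc j. chain_weight x N i)"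
    by (rule sum.reindex_bij_witness[of _ "\<lambda>i. i - 1" Suc])
      (use unitary_dvd_imp_pos in \<open>fastforce simp: y_def\<close>)+
  also have "\<dots> = x * y j"
    using j N by (simp add: y_def sum_chain_weight_unitary_dvd)
  finally show ?thesis by (simp add: x_def y_def)
qed

lemma char_poly_Rstar:
  fixes n N :: nat
  defines "x \<equiv> [:-1, 1:]"
  assumes n: "n > 0" and N: "\<And>j. 0 < j \<Longrightarrow> j \<le> n \<Longrightarrow> omega j \<le> N"
  shows "x ^ N * char_poly (Rstar n) = (x ^ Suc N - (\<Sum>j=2..n. chain_weight x N j)) * x ^ (n - 1)"
proof -
  let ?A = "char_poly_matrix (Rstar n)"
  define y where "y i = chain_weight x N (Suc i)" for i
  have clear: "(\<Sum>i<n. y i * ?A $$ (i, j)) = 0" if "0 < j" "j < n" for j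
    using that N unfolding y_def x_def by (intro sum_chain_weight_char_poly_matrix) auto
  have triangular: "?A $$ (i, j) = 0" if "0 < j" "j < i" "i < n" for i j
    using that unitary_dvd_imp_le[of "Suc i" "Suc j"] by (auto simp: char_poly_matrix_Rstar)
  have y0: "y 0 = x ^ N"
    by (simp add: y_def chain_weight_1)
  have "(\<Sum>i<n. y i * ?A $$ (i, 0)) = x * y 0 + (\<Sum>i=1..<n. - y i)"
    using n by (simp add: char_poly_matrix_Rstar x_def mult.commute lessThan_atLeast0
        sum.atLeast_Suc_lessThan)
  also have "(\<Sum>i=1..<n. - y i) = - (\<Sum>j=2..n. chain_weight x N j)"
    unfolding sum_negf
    by (rule arg_cong[where f = uminus], rule sum.reindex_bij_witness[of _ "\<lambda>i. i - 1" Suc])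
      (auto simp: y_def)
  finally have "(\<Sum>i<n. y i * ?A $$ (i, 0)) = x ^ Suc N - (\<Sum>j=2..n. chain_weight x N j)"
    by (simp add: y0)
  moreover have "(\<Prod>i=1..<n. ?A $$ (i, i)) = x ^ (n - 1)"
    by (simp add: char_poly_matrix_Rstar x_def)
  ultimately show ?thesis
    using det_eq_if_row_combination[OF char_poly_matrix_Rstar(1) n clear triangular]
    by (simp add: y0 char_poly_def)
qed

definition max_omega :: "nat \<Rightarrow> nat" where
  "max_omega n = Max (omega ` {1..n})"

lemma omega_le_max_omega: "0 < m \<Longrightarrow> m \<le> n \<Longrightarrow> omega m \<le> max_omega n"
  by (auto simp: max_omega_def intro!: Max_ge)

lemma ex_omega_eq_max_omega:
  assumes "n > 0"
  obtains m where "0 < m" "m \<le> n" "omega m = max_omega n"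
proof -
  have "max_omega n \<in> omega ` {1..n}"
    unfolding max_omega_def using assms by (intro Max_in) auto
  then obtain m where "m \<in> {1..n}" "max_omega n = omega m" by blast
  then show ?thesis by (intro that[of m]) auto
qed

lemma max_omega_pos: "n \<ge> 2 \<Longrightarrow> max_omega n > 0"
  using omega_le_max_omega[of 2 n] omega_pos[of 2] by simp

lemma kseq_eq_Suc_max_omega:
  assumes "n \<ge> 2"
  shows "kseq n = Suc (max_omega n)"
  using assms
proof (induction n rule: dec_induct)
  case base
  show ?case by (simp add: max_omega_def numeral_2_eq_2 atLeastAtMostSuc_conv)
next
  case (step n)
  then obtain k where k: "n = Suc k" by (cases n) auto
  have "max_omega (Suc n) = max (omega (Suc n)) (max_omega n)"
    using step.hyps by (simp add: max_omega_def atLeastAtMostSuc_conv)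
  then show ?case
    using step.IH by (simp add: k max.commute)
qed

theorem mult_one_add_max_omega:
  assumes "n \<ge> 2"
  shows "mult_one n + max_omega n + 1 = n"
proof -
  define N where "N = max_omega n"
  define x :: "real poly" where "x = [:-1, 1:]"
  define Q where "Q = x ^ Suc N - (\<Sum>j=2..n. chain_weight x N j)"
  have eq: "x ^ N * char_poly (Rstar n) = Q * x ^ (n - 1)"
    unfolding Q_def x_def using assms omega_le_max_omega
    by (intro char_poly_Rstar) (auto simp: N_def)
  have weight: "poly (chain_weight x N j) 1 = real (unitary_chains N j)" for j
  proof -
    have "poly (chain_weight x N j) 1 = (\<Sum>k\<le>N. real (unitary_chains k j) * 0 ^ (N - k))"
      by (simp add: chain_weight_def poly_sum x_def)
    also have "\<dots> = (\<Sum>k\<in>{N}. real (unitary_chains k j) * 0 ^ (N - k))"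
      by (intro sum.mono_neutral_right) auto
    finally show ?thesis by simp
  qed
  obtain m where m: "0 < m" "m \<le> n" "omega m = N"
    unfolding N_def using ex_omega_eq_max_omega[of n] assms by auto
  have "m \<noteq> 1" using m max_omega_pos[OF assms] by (auto simp: N_def)
  have "0 < (\<Sum>j=2..n. real (unitary_chains N j))"
    using m \<open>m \<noteq> 1\<close> unitary_chains_omega_pos[of m] by (intro sum_pos2[of _ m]) auto
  then have "poly Q 1 \<noteq> 0"
    by (simp add: Q_def poly_sum weight) (simp add: x_def)
  then have "Q \<noteq> 0" "order 1 Q = 0" by (auto intro: order_0I)
  moreover have "x \<noteq> 0" "order 1 (x ^ k) = k" for k
    by (simp_all add: x_def order_power_n_n)
  ultimately have "order 1 (Q * x ^ (n - 1)) = n - 1"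
    by (simp add: order_mult)
  moreover have "order 1 (x ^ N * char_poly (Rstar n)) = N + mult_one n"
    using eq \<open>Q \<noteq> 0\<close> \<open>x \<noteq> 0\<close> \<open>\<And>k. order 1 (x ^ k) = k\<close>
    by (subst order_mult) (auto simp: mult_one_def)
  ultimately show ?thesis using eq assms by (simp add: N_def)
qed

lemma mult_one_1: "mult_one 1 = 1"
proof -
  have "omega j \<le> 0" if "0 < j" "j \<le> 1" for j
    using that by (cases "j = 1") auto
  then have "char_poly (Rstar 1) = [:-1, 1:]"
    using char_poly_Rstar[of 1 0] by simp
  then show ?thesis
    using order_power_n_n[of "1::real" 1] by (simp add: mult_one_def)
qed

section \<open>Chebyshev bounds\<close>

definition theta :: "nat \<Rightarrow> real" where
  "theta n = (\<Sum>p\<in>set (primes_upto n). ln (real p))"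

definition prime_count :: "nat \<Rightarrow> nat" where
  "prime_count n = card (set (primes_upto n))"

lemma set_primes_upto_Suc:
  "set (primes_upto (Suc n)) =
    (if prime (Suc n) then insert (Suc n) (set (primes_upto n)) else set (primes_upto n))"
  by (auto simp: set_primes_upto le_Suc_eq)

lemma theta_0 [simp]: "theta 0 = 0"
  by (simp add: theta_def set_primes_upto)


lemma theta_Suc: "theta (Suc n) = (if prime (Suc n) then theta n + ln (real (Suc n)) else theta n)"
proof -
  have "Suc n \<notin> set (primes_upto n)" by (simp add: set_primes_upto)
  then show ?thesis by (simp add: theta_def set_primes_upto_Suc)
qed

lemma prime_count_Suc:
  "prime_count (Suc n) = (if prime (Suc n) then Suc (prime_count n) else prime_count n)"
proof -
  have "Suc n \<notin> set (primes_upto n)" by (simp add: set_primes_upto)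
  then show ?thesis by (simp add: prime_count_def set_primes_upto_Suc)
qed

lemma ln_prime_nonneg: "prime p \<Longrightarrow> 0 \<le> ln (real p)"
  using prime_ge_1_nat[of p] by simp

lemma theta_mono: "m \<le> n \<Longrightarrow> theta m \<le> theta n"
  unfolding theta_def by (intro sum_mono2) (auto simp: set_primes_upto ln_prime_nonneg)

lemma theta_pos: "n \<ge> 2 \<Longrightarrow> theta n > 0"
proof -
  assume "n \<ge> 2"
  have "0 < ln (real 2)" by simp
  also have "\<dots> \<le> theta n"
    unfolding theta_def using \<open>n \<ge> 2\<close>
    by (intro member_le_sum) (auto simp: set_primes_upto ln_prime_nonneg)
  finally show ?thesis .
qed

lemma prime_count_mono: "m \<le> n \<Longrightarrow> prime_count m \<le> prime_count n"
  unfolding prime_count_def by (intro card_mono) (auto simp: set_primes_upto)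

lemma less_if_prime_count_less: "prime_count a < prime_count b \<Longrightarrow> a < b"
  using prime_count_mono[of b a] by linarith

lemma ln_eq_sum_multiplicity:
  fixes n :: nat
  assumes "n > 0"
  shows "ln (real n) = (\<Sum>p\<in>prime_factors n. real (multiplicity p n) * ln (real p))"
proof -
  have pos: "real p > 0" if "p \<in> prime_factors n" for p
    using that by (auto simp: in_prime_factors_iff prime_gt_0_nat)
  have "real n = (\<Prod>p\<in>prime_factors n. real p ^ multiplicity p n)"
    by (subst prime_factorization_nat[OF assms]) simp
  also have "ln \<dots> = (\<Sum>p\<in>prime_factors n. ln (real p ^ multiplicity p n))"
    using pos by (intro ln_prod) auto
  also have "\<dots> = (\<Sum>p\<in>prime_factors n. real (multiplicity p n) * ln (real p))"
    using pos by (intro sum.cong) (simp_all add: ln_realpow)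
  finally show ?thesis .
qed

lemma sum_ln_prime_divisors_le:
  fixes n :: nat
  assumes "n > 0" and "\<And>p. p \<in> S \<Longrightarrow> prime p \<and> p dvd n"
  shows "(\<Sum>p\<in>S. ln (real p)) \<le> ln (real n)"
proof -
  have "(\<Sum>p\<in>S. ln (real p)) \<le> (\<Sum>p\<in>prime_factors n. ln (real p))"
    using assms by (intro sum_mono2) (auto simp: in_prime_factors_iff ln_prime_nonneg)
  also have "\<dots> \<le> (\<Sum>p\<in>prime_factors n. real (multiplicity p n) * ln (real p))"
  proof (intro sum_mono)
    fix p assume p: "p \<in> prime_factors n"
    then have "1 \<le> real (multiplicity p n)"
      by (simp add: prime_factors_multiplicity Suc_le_eq)
    moreover have "0 \<le> ln (real p)" using p by (simp add: in_prime_factors_iff ln_prime_nonneg)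
    ultimately show "ln (real p) \<le> real (multiplicity p n) * ln (real p)"
      using mult_right_mono[of 1 "real (multiplicity p n)" "ln (real p)"] by simp
  qed
  finally show ?thesis by (simp add: ln_eq_sum_multiplicity[OF assms(1)])
qed

lemma binomial_odd_central_le: "(2 * m + 1) choose m \<le> 4 ^ m"
proof -
  have "((2 * m + 1) choose m) + ((2 * m + 1) choose (m + 1))
      = (\<Sum>k\<in>{m, m + 1}. (2 * m + 1) choose k)"
    by simp
  also have "\<dots> \<le> (\<Sum>k\<le>2 * m + 1. (2 * m + 1) choose k)"
    by (intro sum_mono2) auto
  also have "\<dots> = 2 * 4 ^ m"
    by (simp only: choose_row_sum power_add power_mult) simp
  finally show ?thesis
    using binomial_symmetric[of m "2 * m + 1"] by simp
qed

lemma theta_odd_le: "theta (2 * m + 1) \<le> theta (m + 1) + real m * ln 4"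
proof -
  let ?S = "{p. prime p \<and> m + 1 < p \<and> p \<le> 2 * m + 1}"
  have finite: "finite ?S" by (rule finite_subset[of _ "{..2 * m + 1}"]) auto
  have split: "set (primes_upto (2 * m + 1)) = set (primes_upto (m + 1)) \<union> ?S"
    "set (primes_upto (m + 1)) \<inter> ?S = {}"
    by (auto simp: set_primes_upto)
  have "prime p \<and> p dvd ((2 * m + 1) choose m)" if p: "p \<in> ?S" for p
  proof -
    have "p dvd fact (2 * m + 1)" using p by (simp add: prime_dvd_fact_iff del: fact_Suc)
    also have "fact (2 * m + 1) = fact m * fact (m + 1) * ((2 * m + 1) choose m)"
      using binomial_fact_lemma[of m "2 * m + 1"] by simp
    finally show ?thesis
      using p by (simp add: prime_dvd_mult_iff prime_dvd_fact_iff del: fact_Suc)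
  qed
  then have "(\<Sum>p\<in>?S. ln (real p)) \<le> ln (real ((2 * m + 1) choose m))"
    by (intro sum_ln_prime_divisors_le) auto
  also have "\<dots> \<le> ln (4 ^ m)"
    using of_nat_mono[OF binomial_odd_central_le[of m], where 'a = real] by (intro ln_mono) auto
  also have "\<dots> = real m * ln 4" by (simp add: ln_realpow)
  finally show ?thesis
    unfolding theta_def split(1) sum.union_disjoint[OF finite_set finite split(2)] by simp
qed

theorem theta_le: "theta n \<le> real n * ln 4"
proof (induction n rule: less_induct)
  case (less n)
  consider "n = 0" | k where "n = Suc k" "\<not> prime n" | "n = 2" | m where "n = 2 * m + 1" "m > 0"
  proof (cases "prime n \<and> n \<noteq> 2")
    case True
    then have "odd n" "n > 2"
      using prime_odd_nat[of n] prime_ge_2_nat[of n] by auto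
    then show ?thesis using that(4) by (auto elim!: oddE)
  next
    case False
    then show ?thesis using that(1-3) by (cases n) auto
  qed
  then show ?case
  proof cases
    case 1
    then show ?thesis by (simp add: theta_def set_primes_upto)
  next
    case (2 k)
    then have "theta n = theta k" by (simp add: theta_Suc)
    also have "\<dots> \<le> real k * ln 4" using 2 by (intro less.IH) auto
    also have "\<dots> \<le> real n * ln 4" using 2 by (intro mult_right_mono) auto
    finally show ?thesis .
  next
    case 3
    have "set (primes_upto 2) = {2}"
      by (auto simp: set_primes_upto dest: prime_ge_2_nat)
    moreover have "ln 2 \<le> 2 * ln (4 :: real)"
      using ln_mono[of 2 "4 :: real"] ln_ge_zero[of "4 :: real"] by linarith
    ultimately show ?thesis using 3 by (simp add: theta_def)
  next
    case (4 m)
    then have "theta (m + 1) \<le> real (m + 1) * ln 4" by (intro less.IH) auto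
    with theta_odd_le[of m] 4 show ?thesis by (simp add: algebra_simps)
  qed
qed

text \<open>The reciprocals \<open>1 / (m * (n choose m))\<close> form the Leibniz harmonic triangle, in which
  every entry is the difference of two entries in the preceding column.\<close>

lemma mult_binomial_dvd_Lcm:
  assumes "1 \<le> m" "m \<le> n"
  shows "m * (n choose m) dvd Lcm {1..n}"
  using assms
proof (induction m arbitrary: n rule: nat_induct_at_least)
  case base
  then show ?case by (auto intro: dvd_Lcm)
next
  case (Suc m n)
  define D where "D = Lcm {1..n}"
  define e where "e = Suc m * (n choose Suc m)"
  obtain k where k: "n = Suc k" "m \<le> k" using Suc.prems by (cases n) auto
  have e: "e = (n - m) * (n choose m)" "e = n * (k choose m)"
    using k(1) binomial_absorb_comp[of n m]
    unfolding e_def by (simp_all only: binomial_absorption binomial_absorb_comp diff_Suc_1)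
  have "m * (k choose m) dvd Lcm {1..k}" using Suc.IH k by simp
  also have "\<dots> dvd D" unfolding D_def using k by (intro Lcm_subset) auto
  finally obtain s where s: "D = m * (k choose m) * s" by (elim dvdE)
  have "m * (n choose m) dvd D" unfolding D_def using Suc.IH k by simp
  then obtain t where t: "D = m * (n choose m) * t" by (elim dvdE)
  have "n * D = m * e * s" unfolding e(2) s by (simp only: ac_simps)
  moreover have "(n - m) * D = m * e * t" unfolding e(1) t by (simp only: ac_simps)
  ultimately have "m * e * (s - t) = (n - (n - m)) * D"
    by (simp add: diff_mult_distrib diff_mult_distrib2)
  also have "n - (n - m) = m" using k by simp
  finally have "D = e * (s - t)" using Suc.hyps by (simp add: mult.assoc)
  then show ?case by (simp add: D_def e_def)
qed

lemma Lcm_atLeastAtMost_pos: "0 < Lcm {1..n :: nat}"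
  by (rule Nat.gr0I) (simp add: Lcm_0_iff_nat)

lemma two_power_le_Lcm:
  assumes "n \<ge> 2"
  shows "2 ^ (n - 2) \<le> Lcm {1..n}"
proof -
  define m where "m = n div 2"
  have m: "m > 0" "2 * m \<le> n" "n \<le> 2 * m + 1" using assms by (auto simp: m_def)
  have "(2::nat) ^ (n - 2) * 2 \<le> 2 ^ (2 * m)"
    using m unfolding power_Suc2[symmetric] by (intro power_increasing) auto
  also have "\<dots> = 4 ^ m" by (simp add: power_mult)
  also have "4 ^ m \<le> 2 * (m * ((2 * m) choose m))"
  proof -
    have "real (4 ^ m) \<le> real (2 * (m * ((2 * m) choose m)))"
      using central_binomial_lower_bound[of m] m by (simp add: field_simps)
    then show ?thesis by (simp only: of_nat_le_iff)
  qed
  also have "m * ((2 * m) choose m) \<le> Lcm {1..n}"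
  proof (intro dvd_imp_le Lcm_atLeastAtMost_pos)
    have "m * ((2 * m) choose m) dvd Lcm {1..2 * m}"
      using m by (intro mult_binomial_dvd_Lcm) auto
    also have "\<dots> dvd Lcm {1..n}" using m by (intro Lcm_subset) auto
    finally show "m * ((2 * m) choose m) dvd Lcm {1..n}" .
  qed
  finally show ?thesis by simp
qed

lemma ex_multiplicity_Lcm_eq:
  fixes A :: "nat set"
  assumes "finite A" "A \<noteq> {}" "0 \<notin> A" "prime p"
  shows "\<exists>a\<in>A. multiplicity p (Lcm A) = multiplicity p a"
  using assms
proof (induction A rule: finite_ne_induct)
  case (insert a A)
  then have "Lcm A \<noteq> 0" by (simp add: Lcm_0_iff_nat)
  then have "multiplicity p (Lcm (insert a A)) = max (multiplicity p a) (multiplicity p (Lcm A))"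
    using insert.prems by (simp add: multiplicity_lcm)
  with insert show ?case by (auto simp: max_def)
qed simp

lemma power_multiplicity_Lcm_le:
  fixes n p :: nat
  assumes "prime p" "n > 0"
  shows "p ^ multiplicity p (Lcm {1..n}) \<le> n"
proof -
  have "\<exists>k\<in>{1..n}. multiplicity p (Lcm {1..n}) = multiplicity p k"
    using ex_multiplicity_Lcm_eq[of "{1..n}" p] assms by simp
  then obtain k where k: "k \<in> {1..n}" "multiplicity p (Lcm {1..n}) = multiplicity p k" by blast
  have "p ^ multiplicity p k \<le> k" using k(1) by (intro dvd_imp_le multiplicity_dvd) auto
  with k show ?thesis by simp
qed

lemma card_primes_square_le: "real (card {p\<in>set (primes_upto n). p\<^sup>2 \<le> n}) \<le> sqrt (real n)"
proof -
  have "{p\<in>set (primes_upto n). p\<^sup>2 \<le> n} \<subseteq> {1..nat \<lfloor>sqrt (real n)\<rfloor>}"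
  proof clarify
    fix p assume p: "p \<in> set (primes_upto n)" "p\<^sup>2 \<le> n"
    then have "real p \<le> sqrt (real n)"
      by (intro real_le_rsqrt) (simp flip: of_nat_power)
    then show "p \<in> {1..nat \<lfloor>sqrt (real n)\<rfloor>}"
      using p(1) by (simp add: le_nat_floor set_primes_upto prime_gt_0_nat Suc_leI)
  qed
  then have "card {p\<in>set (primes_upto n). p\<^sup>2 \<le> n} \<le> card {1..nat \<lfloor>sqrt (real n)\<rfloor>}"
    by (intro card_mono) auto
  then have "real (card {p\<in>set (primes_upto n). p\<^sup>2 \<le> n}) \<le> real (nat \<lfloor>sqrt (real n)\<rfloor>)"
    by (simp only: card_atLeastAtMost diff_Suc_1 of_nat_le_iff)
  also have "\<dots> \<le> sqrt (real n)" by (rule of_nat_floor) simp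
  finally show ?thesis .
qed

lemma mult_ln_le_if_power_le:
  fixes p n e :: nat
  assumes "prime p" "p ^ e \<le> n"
  shows "real e * ln (real p) \<le> ln (real p) + (if p\<^sup>2 \<le> n then ln (real n) else 0)"
proof (cases "p\<^sup>2 \<le> n")
  case True
  have "real e * ln (real p) = ln (real (p ^ e))"
    using prime_gt_0_nat[OF assms(1)] by (simp add: ln_realpow)
  also have "\<dots> \<le> ln (real n)"
    using of_nat_mono[OF assms(2), where 'a = real] prime_gt_0_nat[OF assms(1)]
    by (intro ln_mono) auto
  finally show ?thesis using True ln_prime_nonneg[OF assms(1)] by simp
next
  case False
  then have "p ^ e < p ^ 2" using assms(2) by simp
  then have "e < 2" by (rule power_less_imp_less_exp[OF prime_gt_1_nat[OF assms(1)]])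
  then have "real e * ln (real p) \<le> 1 * ln (real p)"
    using ln_prime_nonneg[OF assms(1)] by (intro mult_right_mono) auto
  then show ?thesis using False by simp
qed

lemma ln_Lcm_le:
  assumes "n > 0"
  shows "ln (real (Lcm {1..n})) \<le> theta n + sqrt (real n) * ln (real n)"
proof -
  define e where "e p = multiplicity p (Lcm {1..n})" for p
  have power_le: "p ^ e p \<le> n" if "prime p" for p
    unfolding e_def using that assms by (rule power_multiplicity_Lcm_le)
  have sub: "prime_factors (Lcm {1..n}) \<subseteq> set (primes_upto n)"
  proof
    fix p assume "p \<in> prime_factors (Lcm {1..n})"
    then have p: "prime p" "e p > 0" by (auto simp: prime_factors_multiplicity e_def)
    then have "p \<le> p ^ e p" by (intro self_le_power prime_ge_1_nat)
    also have "\<dots> \<le> n" by (rule power_le[OF p(1)])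
    finally show "p \<in> set (primes_upto n)" using p(1) by (simp add: set_primes_upto)
  qed
  have "ln (real (Lcm {1..n})) \<le> (\<Sum>p\<in>set (primes_upto n). real (e p) * ln (real p))"
    unfolding ln_eq_sum_multiplicity[OF Lcm_atLeastAtMost_pos] e_def[symmetric] using sub
    by (intro sum_mono2) (auto simp: set_primes_upto ln_prime_nonneg)
  also have "\<dots> \<le> (\<Sum>p\<in>set (primes_upto n). ln (real p) + (if p\<^sup>2 \<le> n then ln (real n) else 0))"
    by (intro sum_mono mult_ln_le_if_power_le power_le) (simp_all add: set_primes_upto)
  also have "\<dots> = theta n + real (card {p\<in>set (primes_upto n). p\<^sup>2 \<le> n}) * ln (real n)"
    by (simp add: theta_def sum.distrib flip: sum.inter_filter)
  also have "\<dots> \<le> theta n + sqrt (real n) * ln (real n)"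
    using assms card_primes_square_le[of n] by (intro add_left_mono mult_right_mono) auto
  finally show ?thesis .
qed

theorem theta_ge:
  assumes "n \<ge> 2"
  shows "(real n - 2) * ln 2 - sqrt (real n) * ln (real n) \<le> theta n"
proof -
  have "(real n - 2) * ln 2 = ln (real (2 ^ (n - 2)))"
    using assms by (simp add: ln_realpow of_nat_diff)
  also have "\<dots> \<le> ln (real (Lcm {1..n}))"
    using of_nat_mono[OF two_power_le_Lcm[OF assms], where 'a = real] by (intro ln_mono) auto
  also have "\<dots> \<le> theta n + sqrt (real n) * ln (real n)"
    using assms by (intro ln_Lcm_le) simp
  finally show ?thesis by simp
qed

section \<open>Explicit values\<close>

text \<open>Two consecutive convergents of the continued fraction of \<open>e\<close>.\<close>

lemma exp_1_bounds: "1264 / 465 \<le> exp (1 :: real)" "exp (1 :: real) \<le> 1457 / 536"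
  using e_approx_32 by (simp_all only: abs_le_iff) (simp_all add: inverse_eq_divide)

lemma exp_of_nat_le: "exp (real k) \<le> (1457 / 536) ^ k"
  using power_mono[OF exp_1_bounds(2), of k] by (simp flip: exp_of_nat_mult)

lemma exp_leD:
  fixes c x :: real
  assumes "exp c \<le> x"
  shows "0 < x" "c \<le> ln x"
proof -
  show "0 < x" using less_le_trans[OF exp_gt_zero assms] .
  then show "c \<le> ln x" using assms by (simp add: ln_ge_iff)
qed

definition exp_poly :: "real \<Rightarrow> real" where
  "exp_poly w = 1 + w * (1 + w / 2 * (1 + w / 3 * (1 + w / 4 * (1 + w / 5))))"

lemma exp_poly_le_exp: "exp_poly w \<le> exp w"
proof -
  obtain t where "exp w = (\<Sum>m<6. w ^ m / fact m) + exp t / fact 6 * w ^ 6"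
    using Maclaurin_exp_le[of w 6] by blast
  moreover have "(\<Sum>m<6. w ^ m / fact m) = exp_poly w"
    by (simp add: exp_poly_def eval_nat_numeral field_simps)
  ultimately show ?thesis by simp
qed

lemma exp_lower_Taylor_cubic:
  fixes u :: real
  assumes "0 \<le> u"
  shows "1 + u + u\<^sup>2 / 2 + u ^ 3 / 6 \<le> exp u"
proof -
  have "exp_poly u = 1 + u + u\<^sup>2 / 2 + u ^ 3 / 6 + (u ^ 4 / 24 + u ^ 5 / 120)"
    by (simp add: exp_poly_def field_simps eval_nat_numeral)
  moreover have "0 \<le> u ^ 4 / 24 + u ^ 5 / 120" using assms by simp
  ultimately show ?thesis using exp_poly_le_exp[of u] by linarith
qed

text \<open>Splitting off the nearest integer leaves an argument in \<open>[-1/2, 1/2]\<close>, where \<open>exp_poly\<close> is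
  accurate enough for all numerical estimates.\<close>

lemma ln_leI_exp_poly:
  assumes "0 < x" "0 \<le> v" "x \<le> (1264 / 465) ^ nat (round v) * exp_poly (v - of_int (round v))"
  shows "ln x \<le> v"
proof -
  have "0 \<le> round v" using assms(2) by (simp add: round_def)
  note assms(3)
  also have "(1264 / 465) ^ nat (round v) * exp_poly (v - of_int (round v))
      \<le> (1264 / 465) ^ nat (round v) * exp (v - of_int (round v))"
    by (intro mult_left_mono exp_poly_le_exp) auto
  also have "\<dots> \<le> exp 1 ^ nat (round v) * exp (v - of_int (round v))"
    using exp_1_bounds by (intro mult_right_mono power_mono) auto
  also have "\<dots> = exp v"
    using \<open>0 \<le> round v\<close> by (simp flip: exp_of_nat_mult exp_add)
  finally have "ln x \<le> ln (exp v)" using assms(1) by (intro ln_mono)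
  then show ?thesis by simp
qed

lemma ln_geI_exp_poly:
  assumes "0 < x" "0 \<le> v" "(1457 / 536) ^ nat (round v) \<le> x * exp_poly (of_int (round v) - v)"
  shows "v \<le> ln x"
proof -
  have "0 \<le> round v" using assms(2) by (simp add: round_def)
  have "exp 1 ^ nat (round v) \<le> (1457 / 536 :: real) ^ nat (round v)"
    using exp_1_bounds by (intro power_mono) auto
  also note assms(3)
  also have "x * exp_poly (of_int (round v) - v) \<le> x * exp (of_int (round v) - v)"
    using assms(1) by (intro mult_left_mono exp_poly_le_exp) auto
  finally have "exp v \<le> x"
    using \<open>0 \<le> round v\<close> by (simp add: exp_diff field_simps flip: exp_of_nat_mult)
  then show ?thesis using assms(1) by (simp add: ln_ge_iff)
qed

lemmas exp_poly_eval = exp_poly_def round_def power_divide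

lemma primes_upto_330: "primes_upto 330 =
  [2, 3, 5, 7, 11, 13, 17, 19, 23, 29, 31, 37, 41, 43, 47, 53, 59, 61, 67, 71, 73, 79, 83, 89, 97,
   101, 103, 107, 109, 113, 127, 131, 137, 139, 149, 151, 157, 163, 167, 173, 179, 181, 191, 193,
   197, 199, 211, 223, 227, 229, 233, 239, 241, 251, 257, 263, 269, 271, 277, 281, 283, 293, 307,
   311, 313, 317]"
  by code_simp

lemma prime_count_eq_length_filter:
  assumes "n \<le> N"
  shows "prime_count n = length (filter (\<lambda>p. p \<le> n) (primes_upto N))"
proof -
  have "set (primes_upto n) = set (filter (\<lambda>p. p \<le> n) (primes_upto N))"
    using assms by (auto simp: set_primes_upto)
  then show ?thesis
    unfolding prime_count_def
    using distinct_card[OF distinct_filter[OF distinct_primes_upto]] by metis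
qed

lemma theta_eq_theta_add_ln_prod_list:
  assumes "m \<le> n" "n \<le> N"
  shows "theta n = theta m + ln (real (prod_list (filter (\<lambda>p. m < p \<and> p \<le> n) (primes_upto N))))"
proof -
  let ?ps = "filter (\<lambda>p. m < p \<and> p \<le> n) (primes_upto N)"
  have split: "set (primes_upto n) = set (primes_upto m) \<union> set ?ps"
    "set (primes_upto m) \<inter> set ?ps = {}"
    using assms by (auto simp: set_primes_upto)
  have "theta n = theta m + (\<Sum>p\<in>set ?ps. ln (real p))"
    unfolding theta_def split(1) by (rule sum.union_disjoint[OF finite_set finite_set split(2)])
  also have "(\<Sum>p\<in>set ?ps. ln (real p)) = ln (\<Prod>p\<in>set ?ps. real p)"
    by (rule ln_prod[symmetric]) (auto simp: set_primes_upto prime_gt_0_nat)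
  also have "(\<Prod>p\<in>set ?ps. real p) = real (prod_list ?ps)"
    by (simp only: of_nat_prod[symmetric] prod.distinct_set_conv_list distinct_filter
        distinct_primes_upto list.map_ident)
  finally show ?thesis .
qed

lemma prod_list_primes_pos: "0 < prod_list (filter P (primes_upto n))"
  by (auto simp: zero_less_iff_neq_zero prod_list_zero_iff set_primes_upto)

lemma theta_leI_exp_poly:
  assumes "m \<le> n" "n \<le> N" "0 \<le> d"
    and "real (prod_list (filter (\<lambda>p. m < p \<and> p \<le> n) (primes_upto N)))
      \<le> (1264 / 465) ^ nat (round d) * exp_poly (d - of_int (round d))"
  shows "theta n \<le> theta m + d"
  unfolding theta_eq_theta_add_ln_prod_list[OF assms(1,2)]
  using prod_list_primes_pos assms(3,4) by (intro add_left_mono ln_leI_exp_poly) auto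

lemma theta_geI_exp_poly:
  assumes "m \<le> n" "n \<le> N" "0 \<le> d"
    and "(1457 / 536) ^ nat (round d)
      \<le> real (prod_list (filter (\<lambda>p. m < p \<and> p \<le> n) (primes_upto N)))
        * exp_poly (of_int (round d) - d)"
  shows "theta m + d \<le> theta n"
  unfolding theta_eq_theta_add_ln_prod_list[OF assms(1,2)]
  using prod_list_primes_pos assms(3,4) by (intro add_left_mono ln_geI_exp_poly) auto

text \<open>The only prime in \<open>{a..b}\<close> is \<open>a\<close>, so \<open>\<theta>\<close> is constant on each of these intervals.\<close>

definition theta_lower_table :: "(nat \<times> nat \<times> nat \<times> real \<times> real) set" where
  "theta_lower_table =
    {(7, 10, 4, 5.346, 1.677),
     (11, 12, 5, 7.744, 2.047),
     (13, 16, 6, 10.309, 2.334),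
     (17, 18, 7, 13.143, 2.578),
     (19, 22, 8, 16.087, 2.779),
     (23, 28, 9, 19.2229, 2.9562),
     (29, 30, 10, 22.589, 3.118),
     (31, 36, 11, 26.024, 3.26)}"

lemma theta_lower_table_bounds:
  "\<forall>(a, b, r, y, z) \<in> theta_lower_table. prime_count b = r \<and> y \<le> theta a \<and> ln y \<le> z"
proof -
  have "\<forall>(a, b, r, y, z) \<in> theta_lower_table. prime_count b = r"
    by (simp add: theta_lower_table_def prime_count_eq_length_filter[of _ 330] primes_upto_330)
  moreover have "\<forall>(a, b, r, y, z) \<in> theta_lower_table. theta 0 + y \<le> theta a"
    unfolding theta_lower_table_def ball_simps prod.case
    by (intro conjI TrueI theta_geI_exp_poly[where N = 330])
      (simp_all add: primes_upto_330 exp_poly_eval)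
  moreover have "\<forall>(a, b, r, y, z) \<in> theta_lower_table. ln y \<le> z"
    unfolding theta_lower_table_def ball_simps prod.case
    by (intro conjI TrueI ln_leI_exp_poly) (simp_all add: exp_poly_eval)
  ultimately show ?thesis by fastforce
qed

lemma theta_lower_table_cover:
  assumes "7 \<le> n" "n \<le> 36"
  obtains a b r y z where "(a, b, r, y, z) \<in> theta_lower_table" "a \<le> n" "n \<le> b"
    "prime_count n \<le> r" "y \<le> theta n" "ln y \<le> z"
proof -
  have "\<exists>(a, b, r, y, z) \<in> theta_lower_table. a \<le> n \<and> n \<le> b"
    using assms unfolding theta_lower_table_def by simp presburger
  then obtain a b r y z where row: "(a, b, r, y, z) \<in> theta_lower_table" "a \<le> n" "n \<le> b"
    by blast
  then have "prime_count b = r" "y \<le> theta a" "ln y \<le> z"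
    using theta_lower_table_bounds by fastforce+
  with row prime_count_mono[OF row(3)] theta_mono[OF row(2)] show ?thesis
    by (intro that[of a b r y z]) auto
qed

lemma theta_ge_small:
  "5.346 \<le> theta 7" "7.744 \<le> theta 11" "16.087 \<le> theta 19" "19.2229 \<le> theta 23"
  "26.024 \<le> theta 31"
  using theta_lower_table_bounds by (auto simp: theta_lower_table_def)

text \<open>The intervals \<open>{a..b}\<close> are short enough for the bounds \<open>w \<le> ln p\<close> and \<open>ln (\<theta>(p)) \<le> v\<close> on them to
  satisfy the slope conditions of the induction over the primes.\<close>

definition theta_upper_table :: "(nat \<times> nat \<times> real \<times> real \<times> real) set" where
  "theta_upper_table =
    {(29, 30, 22.592, 3.366, 3.118),
     (31, 36, 26.028, 3.431, 3.26),
     (37, 40, 29.641, 3.61, 3.39),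
     (41, 42, 33.355, 3.713, 3.511),
     (43, 46, 37.117, 3.761, 3.616),
     (47, 52, 40.968, 3.85, 3.714),
     (53, 60, 49.016, 3.97, 3.893),
     (61, 72, 61.597, 4.11, 4.121),
     (73, 96, 79.167, 4.29, 4.373),
     (97, 130, 111.928, 4.573, 4.719),
     (131, 178, 157.101, 4.875, 5.057),
     (179, 250, 226.612, 5.187, 5.425),
     (251, 330, 300.017, 5.523, 5.705)}"

lemma theta_upper_table_bounds:
  "\<forall>(a, b, B, w, v) \<in> theta_upper_table. theta b \<le> B \<and> w \<le> ln (real a) \<and> ln B \<le> v"
proof -
  have "\<forall>(m, n, d) \<in> {(0, 30, 22.592), (30, 36, 3.436), (36, 40, 3.613), (40, 42, 3.714),
      (42, 46, 3.762), (46, 52, 3.851), (52, 60, 8.048), (60, 72, 12.581), (72, 96, 17.57),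
      (96, 130, 32.761), (130, 178, 45.173), (178, 250, 69.511), (250, 330, 73.405)}.
    theta n \<le> theta m + d"
    unfolding ball_simps prod.case
    by (intro conjI TrueI theta_leI_exp_poly[where N = 330])
      (simp_all add: primes_upto_330 exp_poly_eval)
  then have "\<forall>(a, b, B, w, v) \<in> theta_upper_table. theta b \<le> B"
    by (simp add: theta_upper_table_def)
  moreover have "\<forall>(a, b, B, w, v) \<in> theta_upper_table. w \<le> ln (real a) \<and> ln B \<le> v"
    unfolding theta_upper_table_def ball_simps prod.case of_nat_numeral
    by (intro conjI TrueI ln_leI_exp_poly ln_geI_exp_poly) (simp_all add: exp_poly_eval)
  ultimately show ?thesis by fastforce
qed

lemma theta_upper_table_cover:
  assumes "29 \<le> p" "p \<le> 330"
  obtains a b B w v where "(a, b, B, w, v) \<in> theta_upper_table" "a \<le> p" "p \<le> b"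
    "w \<le> ln (real p)" "ln (theta p) \<le> v"
proof -
  have "\<exists>(a, b, B, w, v) \<in> theta_upper_table. a \<le> p \<and> p \<le> b"
    using assms unfolding theta_upper_table_def by simp presburger
  then obtain a b B w v where row: "(a, b, B, w, v) \<in> theta_upper_table" "a \<le> p" "p \<le> b"
    by blast
  then have bounds: "theta b \<le> B" "w \<le> ln (real a)" "ln B \<le> v"
    using theta_upper_table_bounds by fastforce+
  have "a > 0" using row(1) by (auto simp: theta_upper_table_def)
  then have "ln (real a) \<le> ln (real p)" using row(2) by (intro ln_mono) auto
  moreover have "ln (theta p) \<le> ln B"
    using theta_mono[OF row(3)] bounds(1) theta_pos[of p] assms by (intro ln_mono) auto
  ultimately show ?thesis using that[OF row] bounds by linarith
qed

section \<open>Slopes of the comparison functions\<close>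

lemma has_real_derivative_div_ln_power:
  assumes "x > 0" "ln x \<noteq> 0"
  shows "((\<lambda>x. x / ln x ^ k) has_real_derivative 1 / ln x ^ k - real k / ln x ^ Suc k) (at x)"
proof -
  have "((\<lambda>x. x / ln x ^ k) has_real_derivative
      (1 * ln x ^ k - x * (real k * ln x ^ (k - 1) * (1 / x))) / (ln x ^ k * ln x ^ k)) (at x)"
    using assms by (auto intro!: derivative_eq_intros)
  also have "(1 * ln x ^ k - x * (real k * ln x ^ (k - 1) * (1 / x))) / (ln x ^ k * ln x ^ k)
      = 1 / ln x ^ k - real k / ln x ^ Suc k"
    using assms by (cases k) (simp_all add: field_simps)
  finally show ?thesis .
qed

lemma div_ln_power_mono:
  fixes x y :: real
  assumes "k > 0" "exp (real k) \<le> x" "x \<le> y"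
  shows "x / ln x ^ k \<le> y / ln y ^ k"
proof (rule DERIV_nonneg_imp_nondecreasing[OF assms(3)])
  fix z assume "x \<le> z" "z \<le> y"
  then have "exp (real k) \<le> z" using assms(2) by simp
  then have z: "z > 0" "real k \<le> ln z"
    by (rule exp_leD)+
  then have "ln z > 0" using assms(1) by linarith
  then have "((\<lambda>x. x / ln x ^ k) has_real_derivative 1 / ln z ^ k - real k / ln z ^ Suc k) (at z)"
    using z(1) by (intro has_real_derivative_div_ln_power) auto
  moreover have "0 \<le> 1 / ln z ^ k - real k / ln z ^ Suc k"
    using z \<open>ln z > 0\<close> by (simp add: field_simps)
  ultimately show "\<exists>d. ((\<lambda>x. x / ln x ^ k) has_real_derivative d) (at z) \<and> 0 \<le> d"
    by blast
qed

definition log_ratio :: "real \<Rightarrow> real" where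
  "log_ratio L = L / ln L"

definition log_ratio_upper :: "real \<Rightarrow> real" where
  "log_ratio_upper L = L / ln L + 2 * L / (ln L)\<^sup>2"

text \<open>Both derivatives depend on \<open>L\<close> only through \<open>u = ln L\<close>, the argument of the slopes.\<close>

definition log_ratio_slope :: "real \<Rightarrow> real" where
  "log_ratio_slope u = 1 / u - 1 / u\<^sup>2"

definition log_ratio_upper_slope :: "real \<Rightarrow> real" where
  "log_ratio_upper_slope u = 1 / u + 1 / u\<^sup>2 - 4 / u ^ 3"

lemma log_ratio_mono:
  assumes "exp 1 \<le> x" "x \<le> y"
  shows "log_ratio x \<le> log_ratio y"
  using div_ln_power_mono[of 1 x y] assms by (simp add: log_ratio_def)

lemma log_ratio_upper_mono:
  assumes "exp 2 \<le> x" "x \<le> y"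
  shows "log_ratio_upper x \<le> log_ratio_upper y"
proof -
  have "exp 1 \<le> (exp 2 :: real)" by simp
  then have "exp 1 \<le> x" using assms by linarith
  then show ?thesis
    using div_ln_power_mono[of 1 x y] div_ln_power_mono[of 2 x y] assms
    by (simp add: log_ratio_upper_def)
qed

lemma has_real_derivative_log_ratio:
  assumes "x > 0" "ln x \<noteq> 0"
  shows "(log_ratio has_real_derivative log_ratio_slope (ln x)) (at x)"
  using has_real_derivative_div_ln_power[OF assms, of 1]
  by (simp add: log_ratio_def[abs_def] log_ratio_slope_def power2_eq_square)

lemma has_real_derivative_log_ratio_upper:
  assumes "x > 0" "ln x \<noteq> 0"
  shows "(log_ratio_upper has_real_derivative log_ratio_upper_slope (ln x)) (at x)"
proof -
  have "((\<lambda>x. x / ln x ^ 1 + 2 * (x / ln x ^ 2)) has_real_derivative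
      (1 / ln x ^ 1 - real 1 / ln x ^ Suc 1) + 2 * (1 / ln x ^ 2 - real 2 / ln x ^ Suc 2)) (at x)"
    using assms by (intro DERIV_add DERIV_cmult has_real_derivative_div_ln_power)
  also have "(\<lambda>x. x / ln x ^ 1 + 2 * (x / ln x ^ 2)) = log_ratio_upper"
    by (simp add: fun_eq_iff log_ratio_upper_def)
  also have "(1 / ln x ^ 1 - real 1 / ln x ^ Suc 1) + 2 * (1 / ln x ^ 2 - real 2 / ln x ^ Suc 2)
      = log_ratio_upper_slope (ln x)"
    by (simp add: log_ratio_upper_slope_def eval_nat_numeral)
  finally show ?thesis .
qed

lemma log_ratio_slope_antimono:
  assumes "2 \<le> u" "u \<le> v"
  shows "log_ratio_slope v \<le> log_ratio_slope u"
proof -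
  define s t where "s = 1 / v" and "t = 1 / u"
  have "0 \<le> s" "s \<le> t" "t \<le> 1 / 2"
    using assms by (auto simp: s_def t_def field_simps)
  then have "0 \<le> (t - s) * (1 - (t + s))" by (intro mult_nonneg_nonneg) auto
  also have "\<dots> = (t - t\<^sup>2) - (s - s\<^sup>2)"
    by (simp add: power2_eq_square algebra_simps)
  finally show ?thesis by (simp add: log_ratio_slope_def s_def t_def power_one_over)
qed

lemma log_ratio_upper_slope_antimono:
  assumes "3 \<le> u" "u \<le> v"
  shows "log_ratio_upper_slope v \<le> log_ratio_upper_slope u"
proof -
  define s t where "s = 1 / v" and "t = 1 / u"
  have st: "0 \<le> s" "s \<le> t" "t \<le> 1 / 3"
    using assms by (auto simp: s_def t_def field_simps)
  then have "t * t \<le> t * (1 / 3)" "t * s \<le> t * (1 / 3)" "s * s \<le> s * (1 / 3)"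
    by (intro mult_left_mono; simp)+
  then have "4 * (t * t + t * s + s * s) \<le> 1 + (t + s)" using st by simp
  then have "0 \<le> (t - s) * (1 + (t + s) - 4 * (t * t + t * s + s * s))"
    using st by (intro mult_nonneg_nonneg) auto
  also have "\<dots> = (t + t\<^sup>2 - 4 * t ^ 3) - (s + s\<^sup>2 - 4 * s ^ 3)"
    by (simp add: power2_eq_square power3_eq_cube algebra_simps)
  finally show ?thesis by (simp add: log_ratio_upper_slope_def s_def t_def power_one_over)
qed

lemma increment_bounds_antimono_slope:
  fixes F \<phi> :: "real \<Rightarrow> real"
  assumes L: "0 < L" "0 \<le> d"
    and deriv: "\<And>x. L \<le> x \<Longrightarrow> x \<le> L + d \<Longrightarrow> (F has_real_derivative \<phi> (ln x)) (at x)"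
    and antimono: "\<And>u v. ln L \<le> u \<Longrightarrow> u \<le> v \<Longrightarrow> \<phi> v \<le> \<phi> u"
  shows "d * \<phi> (ln (L + d)) \<le> F (L + d) - F L" "F (L + d) - F L \<le> d * \<phi> (ln L)"
proof -
  have "d * \<phi> (ln (L + d)) \<le> F (L + d) - F L \<and> F (L + d) - F L \<le> d * \<phi> (ln L)"
  proof (cases "d = 0")
    case False
    then have "L < L + d" using L by simp
    then have "\<exists>z>L. z < L + d \<and> F (L + d) - F L = (L + d - L) * \<phi> (ln z)"
      using deriv by (rule MVT2)
    then obtain z where z: "L < z" "z < L + d" "F (L + d) - F L = d * \<phi> (ln z)"
      by auto
    have "ln L \<le> ln z" "ln z \<le> ln (L + d)" using z L by auto
    then have "\<phi> (ln (L + d)) \<le> \<phi> (ln z)" "\<phi> (ln z) \<le> \<phi> (ln L)"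
      by (auto intro: antimono)
    then show ?thesis unfolding z(3) using L(2) by (auto intro: mult_left_mono)
  qed simp
  then show "d * \<phi> (ln (L + d)) \<le> F (L + d) - F L" "F (L + d) - F L \<le> d * \<phi> (ln L)"
    by auto
qed

section \<open>Comparison of the number of primes with their logarithmic sum\<close>

lemma theta_Suc_increment_bounds:
  fixes F \<phi> :: "real \<Rightarrow> real"
  assumes n: "2 \<le> m" "m \<le> n" "prime (Suc n)"
    and deriv: "\<And>x. theta m \<le> x \<Longrightarrow> (F has_real_derivative \<phi> (ln x)) (at x)"
    and antimono: "\<And>u v. ln (theta m) \<le> u \<Longrightarrow> u \<le> v \<Longrightarrow> \<phi> v \<le> \<phi> u"
  shows "ln (real (Suc n)) * \<phi> (ln (theta (Suc n))) \<le> F (theta (Suc n)) - F (theta n)"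
    "F (theta (Suc n)) - F (theta n) \<le> ln (real (Suc n)) * \<phi> (ln (theta n))"
proof -
  have Suc: "theta (Suc n) = theta n + ln (real (Suc n))" using n(3) by (simp add: theta_Suc)
  have "0 < theta m" "theta m \<le> theta n" using n by (auto intro: theta_pos theta_mono)
  then have "0 < theta n" "ln (theta m) \<le> ln (theta n)" by auto
  note bounds = increment_bounds_antimono_slope[OF \<open>0 < theta n\<close> ln_prime_nonneg[OF n(3)], of F \<phi>]
  show "ln (real (Suc n)) * \<phi> (ln (theta (Suc n))) \<le> F (theta (Suc n)) - F (theta n)"
    unfolding Suc using \<open>theta m \<le> theta n\<close> \<open>ln (theta m) \<le> ln (theta n)\<close>
    by (intro bounds(1) deriv antimono) simp_all
  show "F (theta (Suc n)) - F (theta n) \<le> ln (real (Suc n)) * \<phi> (ln (theta n))"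
    unfolding Suc using \<open>theta m \<le> theta n\<close> \<open>ln (theta m) \<le> ln (theta n)\<close>
    by (intro bounds(2) deriv antimono) simp_all
qed

lemma prime_count_le_if_slope_ge:
  fixes F \<phi> :: "real \<Rightarrow> real"
  assumes "2 \<le> m" "m \<le> n"
    and deriv: "\<And>x. theta m \<le> x \<Longrightarrow> (F has_real_derivative \<phi> (ln x)) (at x)"
    and antimono: "\<And>u v. ln (theta m) \<le> u \<Longrightarrow> u \<le> v \<Longrightarrow> \<phi> v \<le> \<phi> u"
    and slope: "\<And>p. m < p \<Longrightarrow> prime p \<Longrightarrow> 1 \<le> ln (real p) * \<phi> (ln (theta p))"
    and start: "real (prime_count m) + c \<le> F (theta m)"
  shows "real (prime_count n) + c \<le> F (theta n)"
  using assms(2)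
proof (induction n rule: dec_induct)
  case (step n)
  show ?case
  proof (cases "prime (Suc n)")
    case True
    have "1 \<le> ln (real (Suc n)) * \<phi> (ln (theta (Suc n)))"
      using step.hyps True by (intro slope) auto
    also have "\<dots> \<le> F (theta (Suc n)) - F (theta n)"
      by (rule theta_Suc_increment_bounds[OF assms(1) step.hyps(1) True deriv antimono])
    finally show ?thesis using step.IH True by (simp add: prime_count_Suc)
  qed (use step.IH in \<open>simp add: prime_count_Suc theta_Suc\<close>)
qed (fact start)

lemma less_prime_count_if_slope_le:
  fixes F \<phi> :: "real \<Rightarrow> real"
  assumes "2 \<le> m" "m \<le> n"
    and deriv: "\<And>x. theta m \<le> x \<Longrightarrow> (F has_real_derivative \<phi> (ln x)) (at x)"
    and antimono: "\<And>u v. ln (theta m) \<le> u \<Longrightarrow> u \<le> v \<Longrightarrow> \<phi> v \<le> \<phi> u"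
    and slope: "\<And>k. m \<le> k \<Longrightarrow> prime (Suc k) \<Longrightarrow> ln (real (Suc k)) * \<phi> (ln (theta k)) \<le> 1"
    and start: "F (theta m) < real (prime_count m) + c"
  shows "F (theta n) < real (prime_count n) + c"
  using assms(2)
proof (induction n rule: dec_induct)
  case (step n)
  show ?case
  proof (cases "prime (Suc n)")
    case True
    have "F (theta (Suc n)) - F (theta n) \<le> ln (real (Suc n)) * \<phi> (ln (theta n))"
      by (rule theta_Suc_increment_bounds[OF assms(1) step.hyps(1) True deriv antimono])
    also have "\<dots> \<le> 1" using step.hyps(1) True by (rule slope)
    finally show ?thesis using step.IH True by (simp add: prime_count_Suc)
  qed (use step.IH in \<open>simp add: prime_count_Suc theta_Suc\<close>)
qed (fact start)

lemma one_le_mult_if_le: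
  fixes w l s t :: real
  assumes "1 \<le> w * s" "0 \<le> w" "w \<le> l" "s \<le> t"
  shows "1 \<le> l * t"
proof -
  have "0 < w * s" using assms(1) by simp
  then have "0 \<le> s" using assms(2) by (simp add: zero_less_mult_iff)
  then have "w * s \<le> l * t" using assms by (intro mult_mono) auto
  with assms(1) show ?thesis by simp
qed

text \<open>The constant exceeds \<open>ln (ln 4)\<close>.\<close>

lemma ln_theta_le:
  assumes "p \<ge> 2"
  shows "ln (theta p) \<le> ln (real p) + 41 / 125"
proof -
  have "ln 4 \<le> (1.387 :: real)"
    by (rule ln_leI_exp_poly) (simp_all add: exp_poly_eval)
  then have "theta p \<le> real p * 1.387"
    using theta_le[of p] mult_left_mono[of "ln 4" "1.387" "real p"] by linarith
  then have "ln (theta p) \<le> ln (real p * 1.387)"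
    using theta_pos[OF assms] by (intro ln_mono) auto
  also have "\<dots> = ln (real p) + ln 1.387" using assms by (intro ln_mult_pos) auto
  also have "ln 1.387 \<le> (41 / 125 :: real)"
    by (rule ln_leI_exp_poly) (simp_all add: exp_poly_eval)
  finally show ?thesis by simp
qed

lemma log_ratio_slope_mult_ge:
  assumes "429 / 100 \<le> w"
  shows "1 \<le> w * (1.3841 * log_ratio_slope (w + 41 / 125))"
proof -
  define v where "v = w + 41 / 125"
  have v: "v > 0" using assms by (simp add: v_def)
  have "13841 / 10000 * w * (v - 1) - v\<^sup>2
      = 3841 / 10000 * (w * w) - 15861152 / 10000000 * w - 107584 / 1000000"
    by (simp add: v_def power2_eq_square field_simps)
  moreover have "429 / 100 * w \<le> w * w" using assms by (intro mult_right_mono) auto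
  ultimately have "v\<^sup>2 \<le> 13841 / 10000 * w * (v - 1)" using assms by linarith
  also have "\<dots> = w * (1.3841 * log_ratio_slope v) * v\<^sup>2"
    using v by (simp add: log_ratio_slope_def field_simps power2_eq_square)
  finally show ?thesis using v by (simp add: v_def)
qed

lemma log_ratio_slope_mult_ln_prime_ge:
  assumes "29 \<le> p"
  shows "1 \<le> ln (real p) * (1.3841 * log_ratio_slope (ln (theta p)))"
proof -
  have "2 \<le> ln (19.2229 :: real)"
    by (rule ln_geI_exp_poly) (simp_all add: exp_poly_eval)
  also have "\<dots> \<le> ln (theta p)"
    using theta_ge_small(4) theta_mono[of 23 p] assms by (intro ln_mono) auto
  finally have ge_2: "2 \<le> ln (theta p)" .
  have "\<exists>w v. 1 \<le> w * (1.3841 * log_ratio_slope v) \<and> 0 \<le> w \<and> w \<le> ln (real p) \<and> ln (theta p) \<le> v"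
  proof (cases "p \<le> 72")
    case True
    then have "p \<le> 330" by simp
    with assms obtain a b B w v where row: "(a, b, B, w, v) \<in> theta_upper_table" "a \<le> p" "p \<le> b"
        "w \<le> ln (real p)" "ln (theta p) \<le> v"
      by (rule theta_upper_table_cover)
    have "\<forall>(a, b, B, w, v) \<in> theta_upper_table.
        0 \<le> w \<and> (a \<le> 72 \<longrightarrow> 1 \<le> w * (1.3841 * log_ratio_slope v))"
      unfolding theta_upper_table_def
      by (simp add: log_ratio_slope_def power2_eq_square)
    from bspec[OF this row(1)] row True assms
    have "0 \<le> w" "1 \<le> w * (1.3841 * log_ratio_slope v)" by simp_all
    with row show ?thesis by blast
  next
    case False
    have "429 / 100 \<le> ln (73 :: real)"
      by (rule ln_geI_exp_poly) (simp_all add: exp_poly_eval)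
    also have "\<dots> \<le> ln (real p)" using False by (intro ln_mono) auto
    finally show ?thesis
      using log_ratio_slope_mult_ge ln_theta_le[of p] assms
      by (intro exI[of _ "ln (real p)"] exI[of _ "ln (real p) + 41 / 125"]) simp
  qed
  then obtain w v where wv: "1 \<le> w * (1.3841 * log_ratio_slope v)" "0 \<le> w"
    "w \<le> ln (real p)" "ln (theta p) \<le> v" by blast
  show ?thesis
    by (rule one_le_mult_if_le[OF wv(1-3)]) (simp add: log_ratio_slope_antimono[OF ge_2 wv(4)])
qed

lemma log_ratio_upper_slope_mult_ge:
  assumes "2901 / 500 \<le> w"
  shows "1 \<le> w * log_ratio_upper_slope (w + 41 / 125)"
proof -
  define v where "v = w + 41 / 125"
  have v: "v > 0" using assms by (simp add: v_def)
  have "w * (v\<^sup>2 + v - 4) - v ^ 3 = 84 / 125 * (w * w) - 60737 / 15625 * w - 68921 / 1953125"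
    by (simp add: v_def power2_eq_square power3_eq_cube field_simps)
  moreover have "2901 / 500 * w \<le> w * w" using assms by (intro mult_right_mono) auto
  ultimately have "v ^ 3 \<le> w * (v\<^sup>2 + v - 4)" using assms by linarith
  also have "w * (v\<^sup>2 + v - 4) = w * log_ratio_upper_slope v * v ^ 3"
    using v by (simp add: log_ratio_upper_slope_def field_simps power2_eq_square power3_eq_cube)
  finally show ?thesis using v by (simp add: v_def)
qed

lemma log_ratio_upper_slope_mult_ln_prime_ge:
  assumes "37 \<le> p"
  shows "1 \<le> ln (real p) * log_ratio_upper_slope (ln (theta p))"
proof -
  have "3 \<le> ln (26.024 :: real)"
    by (rule ln_geI_exp_poly) (simp_all add: exp_poly_eval)
  also have "\<dots> \<le> ln (theta p)"
    using theta_ge_small(5) theta_mono[of 31 p] assms by (intro ln_mono) auto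
  finally have ge_3: "3 \<le> ln (theta p)" .
  have "\<exists>w v. 1 \<le> w * log_ratio_upper_slope v \<and> 0 \<le> w \<and> w \<le> ln (real p) \<and> ln (theta p) \<le> v"
  proof (cases "p \<le> 330")
    case True
    have "29 \<le> p" using assms by simp
    then obtain a b B w v where row: "(a, b, B, w, v) \<in> theta_upper_table" "a \<le> p" "p \<le> b"
        "w \<le> ln (real p)" "ln (theta p) \<le> v"
      using True by (rule theta_upper_table_cover)
    have "\<forall>(a, b, B, w, v) \<in> theta_upper_table. 0 \<le> w \<and> (37 \<le> b \<longrightarrow> 1 \<le> w * log_ratio_upper_slope v)"
      unfolding theta_upper_table_def
      by (simp add: log_ratio_upper_slope_def power2_eq_square power3_eq_cube)
    from bspec[OF this row(1)] row True assms
    have "0 \<le> w" "1 \<le> w * log_ratio_upper_slope v" by simp_all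
    with row show ?thesis by blast
  next
    case False
    have "2901 / 500 \<le> ln (331 :: real)"
      by (rule ln_geI_exp_poly) (simp_all add: exp_poly_eval)
    also have "\<dots> \<le> ln (real p)" using False by (intro ln_mono) auto
    finally show ?thesis
      using log_ratio_upper_slope_mult_ge ln_theta_le[of p] assms
      by (intro exI[of _ "ln (real p)"] exI[of _ "ln (real p) + 41 / 125"]) simp
  qed
  then obtain w v where wv: "1 \<le> w * log_ratio_upper_slope v" "0 \<le> w"
    "w \<le> ln (real p)" "ln (theta p) \<le> v" by blast
  show ?thesis
    by (rule one_le_mult_if_le[OF wv(1-3) log_ratio_upper_slope_antimono[OF ge_3 wv(4)]])
qed

lemma div_le_log_ratio:
  assumes "1457 / 536 \<le> y" "y \<le> L" "ln y \<le> z"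
  shows "y / z \<le> log_ratio L"
proof -
  have y: "exp 1 \<le> y" using exp_1_bounds(2) assms(1) by linarith
  then have "1 \<le> ln y" by (rule exp_leD)
  then have "y / z \<le> log_ratio y"
    unfolding log_ratio_def using assms by (intro divide_left_mono) auto
  also have "\<dots> \<le> log_ratio L" using y assms(2) by (rule log_ratio_mono)
  finally show ?thesis .
qed

lemma div_le_log_ratio_upper:
  assumes "(1457 / 536)\<^sup>2 \<le> y" "y \<le> L" "ln y \<le> z"
  shows "y / z + 2 * y / z\<^sup>2 \<le> log_ratio_upper L"
proof -
  have y: "exp 2 \<le> y" using exp_of_nat_le[of 2] assms(1) by simp
  then have "y > 0" "2 \<le> ln y" by (rule exp_leD)+
  then have "0 < ln y" "0 < z" using assms(3) by linarith+
  then have "y / z + 2 * y / z\<^sup>2 \<le> log_ratio_upper y"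
    unfolding log_ratio_upper_def using assms(3) \<open>y > 0\<close>
    by (intro add_mono divide_left_mono power_mono mult_pos_pos zero_less_power)
      (simp_all only: less_imp_le)
  also have "\<dots> \<le> log_ratio_upper L" using y assms(2) by (rule log_ratio_upper_mono)
  finally show ?thesis .
qed

lemma prime_count_le_log_ratio_small:
  assumes n: "7 \<le> n" "n \<le> 28"
  shows "real (prime_count n) \<le> 1.3841 * log_ratio (theta n)"
proof -
  have "n \<le> 36" using n by simp
  with n(1) obtain a b r y z where row: "(a, b, r, y, z) \<in> theta_lower_table" "a \<le> n" "n \<le> b"
    "prime_count n \<le> r" "y \<le> theta n" "ln y \<le> z"
    by (rule theta_lower_table_cover)
  have "\<forall>(a, b, r, y, z) \<in> theta_lower_table. 1457 / 536 \<le> y \<and> (a \<le> 28 \<longrightarrow> real r \<le> 1.3841 * (y / z))"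
    by (simp add: theta_lower_table_def)
  from bspec[OF this row(1)] row(2) n(2) have "1457 / 536 \<le> y" "real r \<le> 1.3841 * (y / z)"
    by simp_all
  moreover from this(1) row(5,6) have "y / z \<le> log_ratio (theta n)" by (rule div_le_log_ratio)
  ultimately show ?thesis using row(4) by simp
qed

theorem prime_count_le_log_ratio:
  assumes "7 \<le> n"
  shows "real (prime_count n) \<le> 1.3841 * log_ratio (theta n)"
proof (cases "n \<le> 28")
  case False
  have "(1457 / 536)\<^sup>2 \<le> theta 28"
    using theta_ge_small(4) theta_mono[of 23 28] by (simp add: power_divide)
  then have exp_2: "exp 2 \<le> theta 28" using exp_of_nat_le[of 2] by simp
  have "real (prime_count n) + 0 \<le> 1.3841 * log_ratio (theta n)"
  proof (rule prime_count_le_if_slope_ge[of 28 n _ "\<lambda>u. 1.3841 * log_ratio_slope u"])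
    fix x assume "theta 28 \<le> x"
    with exp_2 have "exp 2 \<le> x" by simp
    then have "0 < x" "2 \<le> ln x" by (rule exp_leD)+
    then show "((\<lambda>L. 1.3841 * log_ratio L) has_real_derivative
        1.3841 * log_ratio_slope (ln x)) (at x)"
      by (intro DERIV_cmult has_real_derivative_log_ratio) auto
  qed (use False prime_count_le_log_ratio_small exp_leD[OF exp_2]
      log_ratio_slope_mult_ln_prime_ge in
      \<open>auto intro!: log_ratio_slope_antimono\<close>)
  then show ?thesis by simp
qed (use prime_count_le_log_ratio_small assms in blast)

lemma Suc_prime_count_le_log_ratio_upper_small:
  assumes n: "13 \<le> n" "n \<le> 36"
  shows "real (prime_count n) + 1 \<le> log_ratio_upper (theta n)"
proof -
  have "7 \<le> n" using n by simp
  then obtain a b r y z where row: "(a, b, r, y, z) \<in> theta_lower_table" "a \<le> n" "n \<le> b"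
    "prime_count n \<le> r" "y \<le> theta n" "ln y \<le> z"
    using n(2) by (rule theta_lower_table_cover)
  have "\<forall>(a, b, r, y, z) \<in> theta_lower_table. 13 \<le> b \<longrightarrow>
      (1457 / 536)\<^sup>2 \<le> y \<and> real r + 1 \<le> y / z + 2 * y / z\<^sup>2"
    by (simp add: theta_lower_table_def power_divide power2_eq_square)
  from bspec[OF this row(1)] row(3) n(1)
  have "(1457 / 536)\<^sup>2 \<le> y" "real r + 1 \<le> y / z + 2 * y / z\<^sup>2" by simp_all
  moreover from this(1) row(5,6) have "y / z + 2 * y / z\<^sup>2 \<le> log_ratio_upper (theta n)"
    by (rule div_le_log_ratio_upper)
  ultimately show ?thesis using row(4) by simp
qed

theorem Suc_prime_count_le_log_ratio_upper:
  assumes "13 \<le> n"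
  shows "real (prime_count n) + 1 \<le> log_ratio_upper (theta n)"
proof (cases "n \<le> 36")
  case False
  have "(1457 / 536) ^ 3 \<le> theta 36"
    using theta_ge_small(5) theta_mono[of 31 36] by (simp add: power_divide)
  then have exp_3: "exp 3 \<le> theta 36" using exp_of_nat_le[of 3] by simp
  show ?thesis
  proof (rule prime_count_le_if_slope_ge[of 36 n _ log_ratio_upper_slope])
    fix x assume "theta 36 \<le> x"
    with exp_3 have "exp 3 \<le> x" by simp
    then have "0 < x" "3 \<le> ln x" by (rule exp_leD)+
    then show "(log_ratio_upper has_real_derivative log_ratio_upper_slope (ln x)) (at x)"
      by (intro has_real_derivative_log_ratio_upper) auto
  qed (use False Suc_prime_count_le_log_ratio_upper_small exp_leD[OF exp_3]
      log_ratio_upper_slope_mult_ln_prime_ge in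
      \<open>auto intro!: log_ratio_upper_slope_antimono\<close>)
qed (use Suc_prime_count_le_log_ratio_upper_small assms in blast)

lemma theta_ge_linear_large:
  assumes "400 \<le> n"
  shows "real n + 1 \<le> exp 1 * theta n"
proof -
  define s where "s = sqrt (real n)"
  have s: "s \<ge> 20" unfolding s_def using assms by (intro real_le_rsqrt) simp
  have n: "s * s = real n" by (simp add: s_def)
  then have "20 * s \<le> real n" using s by (simp flip: n)
  have "ln (s / 20) \<le> s / 20 - 1" using s by (intro ln_le_minus_one) simp
  moreover have "ln s = ln (s / 20) + ln 20" using s by (simp add: ln_div)
  moreover have "ln 20 \<le> (3 :: real)"
    by (rule ln_leI_exp_poly) (simp_all add: exp_poly_eval)
  ultimately have "ln s \<le> 2 + s / 20" by linarith
  then have "2 * s * ln s \<le> 2 * s * (2 + s / 20)" using s by (intro mult_left_mono) auto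
  moreover have "sqrt (real n) * ln (real n) = 2 * s * ln s"
    using s by (simp add: s_def ln_sqrt)
  moreover have "69 / 100 \<le> ln (2 :: real)"
    by (rule ln_geI_exp_poly) (simp_all add: exp_poly_eval)
  then have "(real n - 2) * (69 / 100) \<le> (real n - 2) * ln 2"
    using assms by (intro mult_left_mono) auto
  moreover have "(real n - 2) * ln 2 - sqrt (real n) * ln (real n) \<le> theta n"
    using assms by (intro theta_ge) simp
  ultimately have "(real n - 2) * (69 / 100) - 2 * s * (2 + s / 20) \<le> theta n"
    by linarith
  also have "(real n - 2) * (69 / 100) - 2 * s * (2 + s / 20)
      = 59 / 100 * real n - 4 * s - 138 / 100"
    by (simp add: field_simps flip: n)
  finally have "39 / 100 * real n - 2 \<le> theta n"
    using \<open>20 * s \<le> real n\<close> by linarith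
  have "real n + 1 \<le> 1264 / 465 * (39 / 100 * real n - 2)" using assms by simp
  also have "\<dots> \<le> exp 1 * theta n"
    using \<open>39 / 100 * real n - 2 \<le> theta n\<close> exp_1_bounds(1) assms by (intro mult_mono) auto
  finally show ?thesis .
qed

lemma theta_ge_medium: "37.1 \<le> theta 43" "83.7 \<le> theta 97" "151 \<le> theta 167"
proof -
  have "\<forall>(m, n, d) \<in> {(0, 43, 37.1), (43, 97, 46.6), (97, 167, 68)}. theta m + d \<le> theta n"
    unfolding ball_simps prod.case
    by (intro conjI TrueI theta_geI_exp_poly[where N = 330])
      (simp_all add: primes_upto_330 exp_poly_eval)
  then show "37.1 \<le> theta 43" "83.7 \<le> theta 97" "151 \<le> theta 167" by simp_all
qed

lemma theta_ge_linear:
  assumes "11 \<le> n"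
  shows "real (Suc n) \<le> exp 1 * theta n"
proof -
  have bound: ?thesis if "a \<le> n" "B \<le> theta a" "real (Suc n) \<le> 1264 / 465 * B" "0 \<le> B" for a B
  proof -
    have "1264 / 465 * B \<le> exp 1 * theta n"
      using theta_mono[OF that(1)] that exp_1_bounds(1) by (intro mult_mono) auto
    with that(3) show ?thesis by linarith
  qed
  consider "n \<le> 20" | "20 < n" "n \<le> 42" | "42 < n" "n \<le> 99" | "99 < n" "n \<le> 226"
    | "226 < n" "n \<le> 400" | "400 \<le> n"
    by linarith
  then show ?thesis
  proof cases
    case 1
    then show ?thesis using assms theta_ge_small(2) by (intro bound[of 11 "7.744"]) auto
  next
    case 2
    then show ?thesis using theta_ge_small(3) by (intro bound[of 19 "16.087"]) auto
  next
    case 3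
    then show ?thesis using theta_ge_medium by (intro bound[of 43 "37.1"]) auto
  next
    case 4
    then show ?thesis using theta_ge_medium by (intro bound[of 97 "83.7"]) auto
  next
    case 5
    then show ?thesis using theta_ge_medium by (intro bound[of 167 151]) auto
  next
    case 6
    then show ?thesis using theta_ge_linear_large[of n] by simp
  qed
qed

lemma mult_log_ratio_slope_le_1:
  assumes "2 \<le> u" "d \<le> 1 + u"
  shows "d * log_ratio_slope u \<le> 1"
proof -
  have "d * log_ratio_slope u \<le> (1 + u) * log_ratio_slope u"
    using assms
    by (intro mult_right_mono) (simp_all add: log_ratio_slope_def field_simps power2_eq_square)
  also have "\<dots> = 1 - 1 / u\<^sup>2"
    using assms(1) by (simp add: log_ratio_slope_def field_simps power2_eq_square)
  also have "\<dots> \<le> 1" by simp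
  finally show ?thesis .
qed

theorem log_ratio_theta_less:
  assumes "11 \<le> n"
  shows "log_ratio (theta n) < real (prime_count n) + 1"
proof -
  have "(1457 / 536)\<^sup>2 \<le> theta 11"
    using theta_ge_small(2) by (simp add: power_divide)
  then have exp_2: "exp 2 \<le> theta 11" using exp_of_nat_le[of 2] by simp
  have ln_ge_2: "2 \<le> ln x" if "theta 11 \<le> x" for x
    using that exp_2 by (intro exp_leD(2)) simp
  show ?thesis
  proof (rule less_prime_count_if_slope_le[of 11 n _ log_ratio_slope])
    fix x assume "theta 11 \<le> x"
    then show "(log_ratio has_real_derivative log_ratio_slope (ln x)) (at x)"
      using ln_ge_2[of x] theta_pos[of 11] by (intro has_real_derivative_log_ratio) auto
  next
    fix u v assume "ln (theta 11) \<le> u" "u \<le> v"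
    then show "log_ratio_slope v \<le> log_ratio_slope u"
      using ln_ge_2[of "theta 11"] by (intro log_ratio_slope_antimono) auto
  next
    fix k assume k: "11 \<le> k" "prime (Suc k)"
    define u where "u = ln (theta k)"
    have u: "2 \<le> u" unfolding u_def using theta_mono[OF k(1)] by (rule ln_ge_2)
    have "ln (real (Suc k)) \<le> ln (exp 1 * theta k)"
      using theta_ge_linear[OF k(1)] by (intro ln_mono) auto
    also have "\<dots> = 1 + u" using k(1) theta_pos[of k] by (simp add: u_def ln_mult_pos)
    finally show "ln (real (Suc k)) * log_ratio_slope (ln (theta k)) \<le> 1"
      using u unfolding u_def by (intro mult_log_ratio_slope_le_1)
  next
    have "theta 11 \<le> theta 0 + 8"
      by (rule theta_leI_exp_poly[where N = 330]) (simp_all add: primes_upto_330 exp_poly_eval)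
    moreover have "2 \<le> ln (theta 11)" by (rule ln_ge_2) simp
    ultimately have "log_ratio (theta 11) \<le> 8 / 2"
      unfolding log_ratio_def using theta_pos[of 11] by (intro frac_le) auto
    moreover have "prime_count 11 = 5"
      by (simp add: prime_count_eq_length_filter[of 11 330] primes_upto_330)
    ultimately show "log_ratio (theta 11) < real (prime_count 11) + 1" by simp
  qed (use assms in auto)
qed

section \<open>The largest number of prime factors\<close>

lemma ex_prime_count_eq: "\<exists>n. prime_count n = r"
proof -
  obtain S :: "nat set" where S: "S \<subseteq> {p. prime p}" "finite S" "card S = r"
    using infinite_arbitrarily_large[OF primes_infinite] by blast
  have "S \<subseteq> set (primes_upto (Max S))"
    using S by (auto simp: set_primes_upto)
  then have "r \<le> prime_count (Max S)"
    unfolding prime_count_def S(3)[symmetric] by (intro card_mono) auto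
  moreover have "\<bar>int (prime_count (i + 1)) - int (prime_count i)\<bar> \<le> 1" for i
    by (simp add: prime_count_Suc)
  moreover have "prime_count 0 = 0" by (auto simp: prime_count_def set_primes_upto)
  ultimately have "\<exists>n\<le>Max S. int (prime_count n) = int r"
    by (intro nat0_intermed_int_val) auto
  then show ?thesis by auto
qed

lemma theta_le_sum_ln_primes:
  assumes S: "finite S" "\<And>p. p \<in> S \<Longrightarrow> prime p" and card: "prime_count n \<le> card S"
  shows "theta n \<le> (\<Sum>p\<in>S. ln (real p))"
proof (cases "n = 0")
  case False
  let ?A = "set (primes_upto n)"
  have "card (?A - S) \<le> card (S - ?A)"
    using card card_Int_Diff[of ?A S] card_Int_Diff[OF S(1), of ?A]
    by (simp add: prime_count_def Int_commute)
  have "(\<Sum>p\<in>?A - S. ln (real p)) \<le> real (card (?A - S)) * ln (real n)"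
    by (rule sum_bounded_above) (auto simp: set_primes_upto prime_gt_0_nat intro!: ln_mono)
  also have "\<dots> \<le> real (card (S - ?A)) * ln (real n)"
    using \<open>card (?A - S) \<le> card (S - ?A)\<close> False by (intro mult_right_mono) auto
  also have "\<dots> \<le> (\<Sum>p\<in>S - ?A. ln (real p))"
    using S False by (intro sum_bounded_below) (auto simp: set_primes_upto)
  finally have "(\<Sum>p\<in>?A \<inter> S. ln (real p)) + (\<Sum>p\<in>?A - S. ln (real p))
      \<le> (\<Sum>p\<in>S \<inter> ?A. ln (real p)) + (\<Sum>p\<in>S - ?A. ln (real p))"
    by (simp add: Int_commute)
  then show ?thesis
    unfolding theta_def by (simp add: S(1) flip: sum.Int_Diff)
qed (auto intro!: sum_nonneg ln_prime_nonneg S)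

lemma theta_le_ln_if_prime_count_le_omega:
  assumes "m > 0" "prime_count n \<le> omega m"
  shows "theta n \<le> ln (real m)"
proof -
  have "theta n \<le> (\<Sum>p\<in>prime_factors m. ln (real p))"
    using assms(2) by (intro theta_le_sum_ln_primes) (auto simp: omega_def in_prime_factors_iff)
  also have "\<dots> \<le> ln (real m)"
    using assms(1) by (intro sum_ln_prime_divisors_le) (auto simp: in_prime_factors_iff)
  finally show ?thesis .
qed

lemma ex_theta_le_ln_max_omega:
  assumes "n > 0"
  obtains x where "prime_count x = max_omega n" "theta x \<le> ln (real n)"
proof -
  obtain m where m: "0 < m" "m \<le> n" "omega m = max_omega n"
    using assms by (rule ex_omega_eq_max_omega)
  obtain x where x: "prime_count x = max_omega n"
    using ex_prime_count_eq by blast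
  have "theta x \<le> ln (real m)"
    using m x by (intro theta_le_ln_if_prime_count_le_omega) auto
  also have "\<dots> \<le> ln (real n)" using m by (intro ln_mono) auto
  finally show ?thesis using x that by blast
qed

lemma omega_prod_primes:
  assumes "finite S" "\<And>p. p \<in> S \<Longrightarrow> prime p"
  shows "omega (\<Prod>S) = card S"
proof -
  have "0 \<notin> S" using assms(2) by force
  then have "prime_factors (\<Prod>p\<in>S. p) = \<Union> ((prime_factors \<circ> (\<lambda>p. p)) ` S)"
    using assms(1) by (intro prime_factors_prod) auto
  also have "\<dots> = S" using assms(2) by (auto simp: prime_prime_factors)
  finally show ?thesis by (simp add: omega_def)
qed

lemma prime_count_le_max_omega:
  assumes "n > 0" "theta x \<le> ln (real n)"
  shows "prime_count x \<le> max_omega n"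
proof -
  let ?m = "\<Prod>(set (primes_upto x))"
  have pos: "?m > 0" by (intro prod_pos) (auto simp: set_primes_upto prime_gt_0_nat)
  have "ln (real ?m) = theta x"
    unfolding theta_def of_nat_prod by (intro ln_prod) (auto simp: set_primes_upto prime_gt_0_nat)
  then have "real ?m \<le> real n"
    using assms pos by (metis ln_le_cancel_iff of_nat_0_less_iff)
  then have "?m \<le> n" by (simp only: of_nat_le_iff)
  moreover have "omega ?m = prime_count x"
    unfolding prime_count_def by (intro omega_prod_primes) (auto simp: set_primes_upto)
  ultimately show ?thesis using omega_le_max_omega[of ?m n] pos by simp
qed

lemma ex_theta_le_less_theta_Suc:
  assumes "0 \<le> L"
  obtains x where "theta x \<le> L" "L < theta (Suc x)"
proof -
  obtain p where p: "prime p" "nat \<lceil>exp L\<rceil> < p" using bigger_prime by blast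
  then have "exp L < real p" by linarith
  then have "L < ln (real p)" by (metis exp_gt_zero less_trans ln_exp ln_less_cancel_iff)
  also have "\<dots> \<le> theta p"
    unfolding theta_def using p
    by (intro member_le_sum) (auto simp: set_primes_upto ln_prime_nonneg)
  finally have "\<exists>x. L < theta x" by blast
  then obtain x where "\<not> L < theta x" "L < theta (Suc x)"
    using assms ex_least_nat_less[of "\<lambda>x. L < theta x"] by auto
  then show ?thesis by (intro that) auto
qed

lemma three_le_log_ratio:
  assumes "1 < L"
  shows "3 \<le> 1.3841 * log_ratio L"
proof -
  have "1264 / 465 * ln L \<le> exp 1 * ln L"
    using exp_1_bounds(1) assms by (intro mult_right_mono) auto
  also have "\<dots> \<le> exp 1 * (L / exp 1)"
    using ln_le_minus_one[of "L / exp 1"] assms by (intro mult_left_mono) (auto simp: ln_div)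
  finally have "3 * ln L \<le> 1.3841 * L" using assms ln_gt_zero[OF assms] by simp
  then show ?thesis using assms by (simp add: log_ratio_def field_simps)
qed

lemma six_le_log_ratio_upper:
  assumes "1 < L"
  shows "6 \<le> log_ratio_upper L"
proof -
  define u where "u = ln L"
  have u: "0 < u" "L = exp u" using assms by (auto simp: u_def)
  have "(1 + u + u\<^sup>2 / 2 + u ^ 3 / 6) * (u + 2) - 6 * u\<^sup>2
      = ((u\<^sup>2 - 3)\<^sup>2 + u * (5 * (u - 9 / 5)\<^sup>2 + 9 / 5) + 3) / 6"
    by (simp add: field_simps power2_eq_square power3_eq_cube)
  also have "\<dots> \<ge> 0"
    using u(1) by (intro divide_nonneg_nonneg add_nonneg_nonneg mult_nonneg_nonneg) auto
  finally have "6 * u\<^sup>2 \<le> (1 + u + u\<^sup>2 / 2 + u ^ 3 / 6) * (u + 2)" by simp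
  also have "\<dots> \<le> L * (u + 2)"
    using exp_lower_Taylor_cubic[of u] u by (intro mult_right_mono) auto
  finally show ?thesis
    unfolding log_ratio_upper_def u_def[symmetric] using u(1)
    by (simp add: field_simps power2_eq_square)
qed

lemma one_le_two_mult_div_ln_square:
  fixes L :: real
  assumes "1 < L"
  shows "1 \<le> 2 * L / (ln L)\<^sup>2"
proof -
  have "0 < ln L" using assms by simp
  moreover from this have "1 + ln L + (ln L)\<^sup>2 / 2 \<le> L"
    using exp_lower_Taylor_quadratic[of "ln L"] assms by simp
  ultimately show ?thesis by (simp add: field_simps)
qed

lemma log_ratio_less_4:
  assumes "1.79 \<le> L" "L \<le> 5.35"
  shows "log_ratio L < 4"
proof -
  have "ln (5 / 2 / L) \<le> 5 / 2 / L - 1" using assms by (intro ln_le_minus_one) auto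
  moreover have "ln (5 / 2 / L) = ln (5 / 2) - ln L" using assms by (intro ln_divide_pos) auto
  moreover have "0.916 \<le> ln (5 / 2 :: real)"
    by (rule ln_geI_exp_poly) (simp_all add: exp_poly_eval)
  ultimately have "1.916 - 5 / 2 / L \<le> ln L" by simp
  then have "(1.916 - 5 / 2 / L) * (4 * L) \<le> ln L * (4 * L)"
    using assms by (intro mult_right_mono) auto
  then have "7.664 * L - 10 \<le> 4 * ln L * L" using assms by (simp add: field_simps)
  moreover have "(L - 1.79) * (L - 5.35) \<le> 0" using assms by (intro mult_nonneg_nonpos) auto
  then have "L * L < 7.664 * L - 10" using assms by (simp add: field_simps)
  ultimately have "L * L < 4 * ln L * L" by linarith
  then have "L < 4 * ln L" using assms by (simp only: mult_less_cancel_right)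
  moreover have "0 < ln L" using assms by simp
  ultimately show ?thesis by (simp add: log_ratio_def field_simps)
qed

lemma ln_gt_1:
  assumes "3 \<le> n"
  shows "1 < ln (real n)"
proof -
  have "1.05 \<le> ln (3 :: real)"
    by (rule ln_geI_exp_poly) (simp_all add: exp_poly_eval)
  also have "\<dots> \<le> ln (real n)" using assms by (intro ln_mono) auto
  finally show ?thesis by simp
qed

theorem max_omega_le:
  assumes "3 \<le> n"
  shows "real (max_omega n) \<le> 1.3841 * log_ratio (ln (real n))"
proof (cases "max_omega n \<le> 3")
  case True
  then have "real (max_omega n) \<le> 3" by simp
  also note three_le_log_ratio[OF ln_gt_1[OF assms]]
  finally show ?thesis .
next
  case False
  obtain x where x: "prime_count x = max_omega n" "theta x \<le> ln (real n)"
    using ex_theta_le_ln_max_omega[of n] assms by auto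
  have "prime_count 6 = 3"
    by (simp add: prime_count_eq_length_filter[of 6 330] primes_upto_330)
  then have "7 \<le> x" using less_if_prime_count_less[of 6 x] False x(1) by simp
  then have "theta 7 \<le> theta x" by (rule theta_mono)
  then have "exp 1 \<le> theta x" using theta_ge_small(1) exp_1_bounds(2) by simp
  then have "log_ratio (theta x) \<le> log_ratio (ln (real n))" using x(2) by (rule log_ratio_mono)
  with prime_count_le_log_ratio[OF \<open>7 \<le> x\<close>] x(1) show ?thesis by simp
qed

theorem Suc_max_omega_le:
  assumes "3 \<le> n"
  shows "real (max_omega n) + 1 \<le> log_ratio_upper (ln (real n))"
proof (cases "max_omega n \<le> 5")
  case True
  then have "real (max_omega n) + 1 \<le> 6" by simp
  also note six_le_log_ratio_upper[OF ln_gt_1[OF assms]]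
  finally show ?thesis .
next
  case False
  obtain x where x: "prime_count x = max_omega n" "theta x \<le> ln (real n)"
    using ex_theta_le_ln_max_omega[of n] assms by auto
  have "prime_count 12 = 5"
    by (simp add: prime_count_eq_length_filter[of 12 330] primes_upto_330)
  then have "13 \<le> x" using less_if_prime_count_less[of 12 x] False x(1) by simp
  then have "theta 11 \<le> theta x" by (intro theta_mono) simp
  then have "exp 2 \<le> theta x"
    using theta_ge_small(2) exp_of_nat_le[of 2] by (simp add: power_divide)
  then have "log_ratio_upper (theta x) \<le> log_ratio_upper (ln (real n))"
    using x(2) by (rule log_ratio_upper_mono)
  with Suc_prime_count_le_log_ratio_upper[OF \<open>13 \<le> x\<close>] x(1) show ?thesis by simp
qed

theorem log_ratio_less_max_omega:
  assumes "6 \<le> n"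
  shows "log_ratio (ln (real n)) < real (max_omega n) + 2"
proof -
  define L where "L = ln (real n)"
  have "0 \<le> L" unfolding L_def using assms by simp
  then obtain x where x: "theta x \<le> L" "L < theta (Suc x)"
    by (rule ex_theta_le_less_theta_Suc)
  show ?thesis
  proof (cases "10 \<le> x")
    case True
    then have "theta 7 \<le> theta x" by (intro theta_mono) simp
    then have "exp 1 \<le> L" using x(1) theta_ge_small(1) exp_1_bounds(2) by simp
    then have "log_ratio L \<le> log_ratio (theta (Suc x))" using x(2) by (intro log_ratio_mono) auto
    also have "\<dots> < real (prime_count (Suc x)) + 1" using True by (intro log_ratio_theta_less) simp
    also have "prime_count (Suc x) \<le> max_omega n + 1"
      using prime_count_le_max_omega[of n x] x(1) assms by (simp add: L_def prime_count_Suc)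
    finally show ?thesis by (simp add: L_def)
  next
    case False
    have "theta 10 \<le> theta 0 + 5.35"
      by (rule theta_leI_exp_poly[where N = 330]) (simp_all add: primes_upto_330 exp_poly_eval)
    then have "L \<le> 5.35" using x(2) theta_mono[of "Suc x" 10] False by simp
    moreover have "1.79 \<le> ln (6 :: real)"
      by (rule ln_geI_exp_poly) (simp_all add: exp_poly_eval)
    then have "1.79 \<le> L" unfolding L_def using assms ln_mono[of 6 "real n"] by linarith
    ultimately have "log_ratio L < 4" by (intro log_ratio_less_4)
    moreover have "omega 6 = 2" using omega_prod_primes[of "{2, 3}"] by fastforce
    then have "2 \<le> max_omega n" using omega_le_max_omega[of 6 n] assms by simp
    ultimately show ?thesis by (simp add: L_def)
  qed
qed

lemma log_ratio_minus_le_Suc_max_omega: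
  assumes "3 \<le> n"
  shows "log_ratio (ln (real n)) - 2 * ln (real n) / (ln (ln (real n)))\<^sup>2 \<le> real (max_omega n) + 1"
proof -
  define L where "L = ln (real n)"
  have L: "1 < L" unfolding L_def by (rule ln_gt_1[OF assms])
  have "log_ratio L - 2 * L / (ln L)\<^sup>2 \<le> real (max_omega n) + 1"
  proof (cases "6 \<le> n")
    case True
    have "log_ratio L < real (max_omega n) + 2"
      unfolding L_def by (rule log_ratio_less_max_omega[OF True])
    with one_le_two_mult_div_ln_square[OF L] show ?thesis by linarith
  next
    case False
    then have "L \<le> ln 5" unfolding L_def using assms by (intro ln_mono) auto
    also have "ln 5 \<le> (2 :: real)"
      by (rule ln_leI_exp_poly) (simp_all add: exp_poly_eval)
    finally have "ln L \<le> 1" using ln_le_minus_one[of L] L by linarith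
    moreover have "0 < ln L" using L by simp
    ultimately have "log_ratio L \<le> 2 * L / (ln L)\<^sup>2"
      using L by (simp add: log_ratio_def field_simps power2_eq_square)
    then show ?thesis by simp
  qed
  then show ?thesis by (simp add: L_def)
qed

lemma real_mult_one_eq:
  assumes "2 \<le> n"
  shows "real (mult_one n) = real n - (real (max_omega n) + 1)"
  using mult_one_add_max_omega[OF assms] by linarith

lemma mult_one_eq_diff_kseq:
  assumes "1 \<le> n"
  shows "mult_one n = n - kseq n"
proof (cases "n = 1")
  case False
  with assms have "2 \<le> n" by simp
  then show ?thesis
    using mult_one_add_max_omega[of n] kseq_eq_Suc_max_omega[of n] by simp
qed (use mult_one_1 in simp)

theorem theorem4:
  shows "(\<forall>n::nat. n \<ge> 1 \<longrightarrow> mult_one n = n - kseq n)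
    \<and> (\<forall>n::nat. n \<ge> 3 \<longrightarrow>
          real n - of_int \<lfloor>1.3841 * ln (real n) / ln (ln (real n))\<rfloor> - 1 \<le> real (mult_one n))
    \<and> (\<forall>n::nat. n \<ge> 6 \<longrightarrow>
          real (mult_one n) \<le> real n - of_int \<lfloor>ln (real n) / ln (ln (real n))\<rfloor>)
    \<and> (\<forall>n::nat. n \<ge> 3 \<longrightarrow>
          \<bar>real (mult_one n) - real n + ln (real n) / ln (ln (real n))\<bar>
            \<le> 2 * ln (real n) / (ln (ln (real n)))^2)"
proof (intro conjI allI impI)
  fix n :: nat assume "n \<ge> 1"
  then show "mult_one n = n - kseq n" by (rule mult_one_eq_diff_kseq)
next
  fix n :: nat assume n: "n \<ge> 3"
  then have "real_of_int (int (max_omega n)) \<le> 1.3841 * ln (real n) / ln (ln (real n))"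
    using max_omega_le by (simp add: log_ratio_def)
  then have "int (max_omega n) \<le> \<lfloor>1.3841 * ln (real n) / ln (ln (real n))\<rfloor>"
    by (simp only: le_floor_iff)
  with n show "real n - of_int \<lfloor>1.3841 * ln (real n) / ln (ln (real n))\<rfloor> - 1 \<le> real (mult_one n)"
    by (simp add: real_mult_one_eq)
next
  fix n :: nat assume n: "n \<ge> 6"
  then have "\<lfloor>ln (real n) / ln (ln (real n))\<rfloor> < int (max_omega n) + 2"
    using log_ratio_less_max_omega by (simp add: log_ratio_def floor_less_iff)
  with n show "real (mult_one n) \<le> real n - of_int \<lfloor>ln (real n) / ln (ln (real n))\<rfloor>"
    by (simp add: real_mult_one_eq)
next
  fix n :: nat assume n: "n \<ge> 3"
  then show "\<bar>real (mult_one n) - real n + ln (real n) / ln (ln (real n))\<bar>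
      \<le> 2 * ln (real n) / (ln (ln (real n)))^2"
    using Suc_max_omega_le[OF n] log_ratio_minus_le_Suc_max_omega[OF n]
    by (simp add: real_mult_one_eq log_ratio_def log_ratio_upper_def abs_le_iff)
qed

end
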